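(* Let $c$ be a positive integer and let $G_1$ and $G_2$ be finitely generated torsion-free nilpotent groups of nilpotency class $c$ whose Malcev completions are isomorphic, $G_1^{\ast} \simeq G_2^{\ast}$. Then $G_1$ is strongly recurrent self-similar if and only if $G_2$ is strongly recurrent self-similar.
   Context: For a finitely generated torsion-free nilpotent group $G$, $G^{\ast}$ denotes its Malcev completion: the (unique up to isomorphism over $G$) torsion-free nilpotent group containing $G$ in which every element has a unique $n$-th root for each $n \geq 1$ and in which every element has some positive power lying in $G$. A virtual endomorphism of a group $G$ is a homomorphism $f : K \to G$ from a subgroup $K \leqslant G$ of finite index into $G$. The $f$-core of $K$ is the largest subgroup $N \leqslant K$ which is normal in $G$ and $f$-invariant ($N^f \leqslant N$). The virtual endomorphism $f$ is simple if the $f$-core of $K$ is trivial, i.e. the only subgroup $N \leqslant K$ with $N \trianglelefteq G$ and $N^f \leqslant N$ is $N = 1$. It is recurrent if $f : K \to G$ is surjective. A group $G$ is strongly recurrent self-similar if for every finite-index subgroup $H$ of $G$ there exist a finite-index subgroup $K$ of $H$ and a simple recurrent virtual endomorphism $f : K \to G$. *)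

theory Defs
  imports "HOL-Algebra.Algebra"
begin

definition commutator_subgroup :: "('a, 'b) monoid_scheme \<Rightarrow> 'a set \<Rightarrow> 'a set \<Rightarrow> 'a set" where
  "commutator_subgroup G H K =
     generate G (\<Union>h\<in>H. \<Union>k\<in>K. {h \<otimes>\<^bsub>G\<^esub> k \<otimes>\<^bsub>G\<^esub> inv\<^bsub>G\<^esub> h \<otimes>\<^bsub>G\<^esub> inv\<^bsub>G\<^esub> k})"

(* Indexing from 0: lower_central G n is the (n+1)-st term of the lower central series. *)
primrec lower_central :: "('a, 'b) monoid_scheme \<Rightarrow> nat \<Rightarrow> 'a set" where
  "lower_central G 0 = carrier G"
| "lower_central G (Suc n) = commutator_subgroup G (lower_central G n) (carrier G)"

definition nilpotent_group :: "('a, 'b) monoid_scheme \<Rightarrow> bool" where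
  "nilpotent_group G \<longleftrightarrow> group G \<and> (\<exists>n. lower_central G n = {\<one>\<^bsub>G\<^esub>})"

definition nilpotency_class :: "('a, 'b) monoid_scheme \<Rightarrow> nat" where
  "nilpotency_class G = (LEAST n. lower_central G n = {\<one>\<^bsub>G\<^esub>})"

definition torsion_free_group :: "('a, 'b) monoid_scheme \<Rightarrow> bool" where
  "torsion_free_group G \<longleftrightarrow>
     group G \<and> (\<forall>x\<in>carrier G. \<forall>n::nat. n \<ge> 1 \<and> x [^]\<^bsub>G\<^esub> n = \<one>\<^bsub>G\<^esub> \<longrightarrow> x = \<one>\<^bsub>G\<^esub>)"

definition fin_generated_group :: "('a, 'b) monoid_scheme \<Rightarrow> bool" where
  "fin_generated_group G \<longleftrightarrow>
     group G \<and> (\<exists>S. finite S \<and> S \<subseteq> carrier G \<and> generate G S = carrier G)"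

(* The containment of G in its completion M is an embedding; M may live in any type. *)
definition malcev_completion :: "('a, 'b) monoid_scheme \<Rightarrow> ('m, 'n) monoid_scheme \<Rightarrow> bool" where
  "malcev_completion G M \<longleftrightarrow>
     torsion_free_group M \<and> nilpotent_group M \<and>
     (\<forall>n::nat. n \<ge> 1 \<longrightarrow> (\<forall>x\<in>carrier M. \<exists>!y. y \<in> carrier M \<and> y [^]\<^bsub>M\<^esub> n = x)) \<and>
     (\<exists>\<iota> \<in> mon G M. \<forall>x\<in>carrier M. \<exists>n::nat. n \<ge> 1 \<and> x [^]\<^bsub>M\<^esub> n \<in> \<iota> ` carrier G)"

definition finite_index_subgroup :: "'a set \<Rightarrow> ('a, 'b) monoid_scheme \<Rightarrow> bool" where
  "finite_index_subgroup H G \<longleftrightarrow> subgroup H G \<and> finite (rcosets\<^bsub>G\<^esub> H)"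

definition virtual_endomorphism ::
    "('a, 'b) monoid_scheme \<Rightarrow> 'a set \<Rightarrow> ('a \<Rightarrow> 'a) \<Rightarrow> bool" where
  "virtual_endomorphism G K f \<longleftrightarrow>
     finite_index_subgroup K G \<and> f \<in> hom (G\<lparr>carrier := K\<rparr>) G"

definition simple_virtual_endomorphism ::
    "('a, 'b) monoid_scheme \<Rightarrow> 'a set \<Rightarrow> ('a \<Rightarrow> 'a) \<Rightarrow> bool" where
  "simple_virtual_endomorphism G K f \<longleftrightarrow>
     virtual_endomorphism G K f \<and>
     (\<forall>N. N \<subseteq> K \<and> N \<lhd> G \<and> f ` N \<subseteq> N \<longrightarrow> N = {\<one>\<^bsub>G\<^esub>})"

definition recurrent_virtual_endomorphism ::
    "('a, 'b) monoid_scheme \<Rightarrow> 'a set \<Rightarrow> ('a \<Rightarrow> 'a) \<Rightarrow> bool" where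
  "recurrent_virtual_endomorphism G K f \<longleftrightarrow>
     virtual_endomorphism G K f \<and> f ` K = carrier G"

definition strongly_recurrent_self_similar :: "('a, 'b) monoid_scheme \<Rightarrow> bool" where
  "strongly_recurrent_self_similar G \<longleftrightarrow>
     (\<forall>H. finite_index_subgroup H G \<longrightarrow>
       (\<exists>K f. finite_index_subgroup K (G\<lparr>carrier := H\<rparr>) \<and>
              simple_virtual_endomorphism G K f \<and>
              recurrent_virtual_endomorphism G K f))"

end

theory Submission
  imports Defs
begin

text \<open>
  Both groups embed into one completion \<open>M\<close>, and every element of \<open>M\<close> has a power in either image,
  so the images are commensurable. Let \<open>m\<close> be such that \<open>x ^ m \<in> G1\<close> for all \<open>x \<in> G2\<close>. A finite-index
  subgroup \<open>H2\<close> of \<open>G2\<close> has a subgroup of finite index all of whose elements are \<open>m\<close>-th powers in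
  \<open>H2\<close>; self-similarity of \<open>G1\<close>, applied to the intersection of this subgroup with \<open>G1\<close>, gives a
  simple surjection \<open>f\<close> from some \<open>K\<close> onto \<open>G1\<close>. The root closure of the graph of \<open>f\<close> in \<open>M \<times> M\<close> is a
  subgroup, because \<open>M \<times> M\<close> is nilpotent, and the graph of a function, because roots are unique. It
  restricts to a homomorphism \<open>f2\<close> from a finite-index subgroup of \<open>H2\<close> onto \<open>G2\<close>: given \<open>x \<in> G2\<close>, write
  \<open>x ^ m = f (y ^ m)\<close> with \<open>y \<in> H2\<close>. If a nontrivial normal subgroup \<open>N\<close> of \<open>G2\<close> were invariant under
  \<open>f2\<close>, then so would be its nontrivial intersection with the centre of \<open>G2\<close>; that intersection is
  central in \<open>M\<close>, and suitable powers of its elements form a nontrivial normal subgroup of \<open>G1\<close>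
  invariant under \<open>f\<close>.

  The facts on powers are proved along the lower central series, using that commutators are
  bilinear modulo the next term: \<open>[a ^ k, g ^ l]\<close> is congruent to \<open>[a, g] ^ (k * l)\<close>.
\<close>

section \<open>Commutators and the lower central series of a subgroup\<close>

text \<open>Written with the same convention as the generators in
  \<open>commutator_subgroup\<close>, so that identities can be stated for a single
  generator.\<close>

definition comm :: "('a, 'b) monoid_scheme \<Rightarrow> 'a \<Rightarrow> 'a \<Rightarrow> 'a" where
  "comm G x y = x \<otimes>\<^bsub>G\<^esub> y \<otimes>\<^bsub>G\<^esub> inv\<^bsub>G\<^esub> x \<otimes>\<^bsub>G\<^esub> inv\<^bsub>G\<^esub> y"

section \<open>Commutator identities\<close>

context group
begin

lemma inv_mult_cancel [simp]:
  "x \<in> carrier G \<Longrightarrow> y \<in> carrier G \<Longrightarrow> inv x \<otimes> (x \<otimes> y) = y"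
  "x \<in> carrier G \<Longrightarrow> y \<in> carrier G \<Longrightarrow> x \<otimes> (inv x \<otimes> y) = y"
  by (simp_all add: m_assoc [symmetric])

lemma comm_closed [simp]: "x \<in> carrier G \<Longrightarrow> y \<in> carrier G \<Longrightarrow> comm G x y \<in> carrier G"
  by (simp add: comm_def)

lemma comm_in_subgroup: "subgroup H G \<Longrightarrow> x \<in> H \<Longrightarrow> y \<in> H \<Longrightarrow> comm G x y \<in> H"
  by (simp add: comm_def subgroup.m_closed subgroup.m_inv_closed)

lemma inv_comm: "x \<in> carrier G \<Longrightarrow> y \<in> carrier G \<Longrightarrow> inv (comm G x y) = comm G y x"
  by (simp add: comm_def inv_mult_group m_assoc)

lemma comm_mult: "x \<in> carrier G \<Longrightarrow> y \<in> carrier G \<Longrightarrow> comm G x y \<otimes> (y \<otimes> x) = x \<otimes> y"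
  by (simp add: comm_def m_assoc)

lemma conj_eq_comm: "x \<in> carrier G \<Longrightarrow> y \<in> carrier G \<Longrightarrow> x \<otimes> y \<otimes> inv x = comm G x y \<otimes> y"
  by (simp add: comm_def m_assoc)

lemma comm_eq_one_iff:
  "x \<in> carrier G \<Longrightarrow> y \<in> carrier G \<Longrightarrow> comm G x y = \<one> \<longleftrightarrow> x \<otimes> y = y \<otimes> x"
  by (metis comm_mult comm_closed l_one m_closed r_cancel_one')

lemma comm_one: "x \<in> carrier G \<Longrightarrow> comm G x \<one> = \<one>" "x \<in> carrier G \<Longrightarrow> comm G \<one> x = \<one>"
  by (simp_all add: comm_def)

text \<open>The deviation from linearity is a nested commutator rather than a conjugate: if
  \<open>a\<close> lies in the term with index n of the lower central series, the factor
  \<open>comm G g (comm G a h)\<close> lies in the term with index n + 2.\<close>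

lemma comm_mult_right:
  assumes "a \<in> carrier G" "g \<in> carrier G" "h \<in> carrier G"
  shows "comm G a (g \<otimes> h) = comm G a g \<otimes> comm G g (comm G a h) \<otimes> comm G a h"
  using assms by (simp add: comm_def inv_mult_group m_assoc)

lemma comm_mult_left:
  assumes "a \<in> carrier G" "b \<in> carrier G" "g \<in> carrier G"
  shows "comm G (a \<otimes> b) g = comm G a (comm G b g) \<otimes> comm G b g \<otimes> comm G a g"
  using assms by (simp add: comm_def inv_mult_group m_assoc)

lemma comm_inv_right:
  assumes "a \<in> carrier G" "g \<in> carrier G"
  shows "comm G a (inv g) = comm G (inv g) (inv (comm G a g)) \<otimes> inv (comm G a g)"
  using assms by (simp add: comm_def inv_mult_group m_assoc)

lemma comm_inv_left:
  assumes "a \<in> carrier G" "g \<in> carrier G"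
  shows "comm G (inv a) g = inv (comm G a g) \<otimes> comm G (comm G a g) (inv a)"
  using assms by (simp add: comm_def inv_mult_group m_assoc)

text \<open>If [a, g] commutes with g, the correction [g^k, [a, g]] in
  \<open>comm_mult_right\<close> vanishes. In a quotient where [a, g] becomes central this is
  linearity on powers.\<close>

lemma comm_pow_right:
  assumes a: "a \<in> carrier G" and g: "g \<in> carrier G"
    and c: "comm G a g \<otimes> g = g \<otimes> comm G a g"
  shows "comm G a (g [^] (k::nat)) = comm G a g [^] k"
proof (induction k)
  case (Suc k)
  have "g [^] k \<otimes> comm G a g = comm G a g \<otimes> g [^] k"
    using c a g by (metis comm_closed group_commutes_pow)
  then have "comm G (g [^] k) (comm G a g) = \<one>"
    using a g by (simp add: comm_eq_one_iff)
  then show ?case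
    using a g Suc by (simp add: comm_mult_right)
qed (use a in \<open>simp add: comm_one\<close>)

lemma comm_pow_left:
  assumes a: "a \<in> carrier G" and g: "g \<in> carrier G"
    and c: "comm G a g \<otimes> a = a \<otimes> comm G a g"
  shows "comm G (a [^] (k::nat)) g = comm G a g [^] k"
proof (induction k)
  case (Suc k)
  have "a [^] k \<otimes> comm G a g = comm G a g \<otimes> a [^] k"
    using c a g by (metis comm_closed group_commutes_pow)
  then have "comm G (a [^] k) (comm G a g) = \<one>"
    using a g by (simp add: comm_eq_one_iff)
  then show ?case
    using a g Suc nat_pow_mult[of "comm G a g" 1 k]
    by (simp add: comm_mult_left nat_pow_Suc2 del: nat_pow_Suc)
qed (use g in \<open>simp add: comm_one\<close>)

end

text \<open>The lower central series of a subgroup, kept as sets inside the ambient group so that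
  the series of different subgroups can be compared. As for \<open>lower_central\<close>, index 0 is
  the whole subgroup.\<close>

primrec lcs :: "('a, 'b) monoid_scheme \<Rightarrow> 'a set \<Rightarrow> nat \<Rightarrow> 'a set" where
  "lcs G H 0 = H"
| "lcs G H (Suc n) = commutator_subgroup G (lcs G H n) H"

lemma lower_central_eq_lcs: "lower_central G n = lcs G (carrier G) n"
  by (induction n) auto

section \<open>The terms of the series and their central quotients\<close>

context group
begin

lemma commutator_subgroup_eq_generate:
  "commutator_subgroup G H K = generate G {comm G h k | h k. h \<in> H \<and> k \<in> K}"
  unfolding commutator_subgroup_def comm_def by (rule arg_cong [of _ _ "generate G"]) blast

lemma lcs_Suc: "lcs G H (Suc n) = generate G {comm G a g | a g. a \<in> lcs G H n \<and> g \<in> H}"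
  by (simp add: commutator_subgroup_eq_generate)

text \<open>One induction proves all three claims: a commutator with first entry in the term of
  index n + 1 is a generator of that same term, because that term lies in the term of index
  n.\<close>

lemma lcs_aux:
  assumes H: "subgroup H G"
  shows "subgroup (lcs G H n) G \<and> lcs G H n \<subseteq> H \<and> lcs G H (Suc n) \<subseteq> lcs G H n"
proof (induction n)
  case 0
  then show ?case
    using H by (auto simp: lcs_Suc simp del: lcs.simps(2)
        intro!: comm_in_subgroup dest!: generate_subgroup_incl [OF _ H, THEN subsetD, rotated])
next
  case (Suc n)
  have HG: "H \<subseteq> carrier G"
    by (rule subgroup.subset [OF H])
  let ?A = "lcs G H (Suc n)"
  have sub: "subgroup ?A G"
    unfolding lcs_Suc using Suc HG by (intro generate_is_subgroup) (auto intro!: comm_closed)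
  have "comm G a g \<in> ?A" if "a \<in> ?A" "g \<in> H" for a g
    unfolding lcs_Suc using Suc that by (intro generate.incl) auto
  then have "lcs G H (Suc (Suc n)) \<subseteq> ?A"
    unfolding lcs_Suc [of H "Suc n"] by (intro generate_subgroup_incl sub) auto
  then show ?case
    using Suc sub by blast
qed

lemma lcs_subgroup: "subgroup H G \<Longrightarrow> subgroup (lcs G H n) G"
  and lcs_subset: "subgroup H G \<Longrightarrow> lcs G H n \<subseteq> H"
  and lcs_Suc_subset: "subgroup H G \<Longrightarrow> lcs G H (Suc n) \<subseteq> lcs G H n"
  using lcs_aux by blast+

lemma comm_in_lcs:
  assumes "subgroup H G" "a \<in> lcs G H n" "g \<in> H"
  shows "comm G a g \<in> lcs G H (Suc n)" "comm G g a \<in> lcs G H (Suc n)"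
proof -
  show *: "comm G a g \<in> lcs G H (Suc n)"
    unfolding lcs_Suc using assms by (intro generate.incl) auto
  have "a \<in> carrier G" "g \<in> carrier G"
    using assms lcs_subset [of H n] subgroup.subset by blast+
  then show "comm G g a \<in> lcs G H (Suc n)"
    using * subgroup.m_inv_closed [OF lcs_subgroup [OF assms(1)]] by (metis inv_comm)
qed

lemma lcs_mono: "H \<subseteq> H' \<Longrightarrow> lcs G H n \<subseteq> lcs G H' n"
proof (induction n)
  case (Suc n)
  then show ?case
    unfolding lcs_Suc by (intro mono_generate) blast
qed simp

lemma lcs_normal:
  assumes H: "subgroup H G"
  shows "lcs G H n \<lhd> G\<lparr>carrier := H\<rparr>"
proof -
  interpret P: group "G\<lparr>carrier := H\<rparr>"
    using H by (rule subgroup_imp_group)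
  have HG: "H \<subseteq> carrier G" and LH: "lcs G H n \<subseteq> H"
    using H by (simp_all add: subgroup.subset lcs_subset)
  have "x \<otimes> a \<otimes> inv x \<in> lcs G H n" if "x \<in> H" "a \<in> lcs G H n" for x a
  proof -
    have "x \<otimes> a \<otimes> inv x = comm G x a \<otimes> a"
      using that HG LH by (intro conj_eq_comm) auto
    then show ?thesis
      using comm_in_lcs(2) [OF H that(2,1)] lcs_Suc_subset [OF H, of n] that(2)
      by (simp del: lcs.simps) (blast intro: subgroup.m_closed [OF lcs_subgroup [OF H]])
  qed
  then show ?thesis
    using H by (auto simp: P.normal_inv_iff intro!: subgroup_incl lcs_subgroup lcs_subset)
qed

text \<open>A set of rewriting rules for the projection modulo a term of the series. Congruences are
  carried into the quotient, computed there, and brought back by the third rule.\<close>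

lemma lcs_quotient:
  fixes n :: nat
  assumes P: "subgroup P G"
  defines "Q \<equiv> G\<lparr>carrier := P\<rparr> Mod lcs G P n" and "\<pi> \<equiv> \<lambda>x. lcs G P n #> x"
  shows "group Q" "group_hom (G\<lparr>carrier := P\<rparr>) Q \<pi>"
    "\<And>x y. x \<in> P \<Longrightarrow> y \<in> P \<Longrightarrow> \<pi> x = \<pi> y \<longleftrightarrow> x \<otimes> inv y \<in> lcs G P n"
    "\<And>x. x \<in> P \<Longrightarrow> \<pi> x \<in> carrier Q"
    "\<And>x y. x \<in> P \<Longrightarrow> y \<in> P \<Longrightarrow> \<pi> (x \<otimes> y) = \<pi> x \<otimes>\<^bsub>Q\<^esub> \<pi> y"
    "\<And>x. x \<in> P \<Longrightarrow> \<pi> (inv x) = inv\<^bsub>Q\<^esub> (\<pi> x)"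
    "\<And>x k. x \<in> P \<Longrightarrow> \<pi> (x [^] (k::nat)) = \<pi> x [^]\<^bsub>Q\<^esub> k"
    "\<And>x y. x \<in> P \<Longrightarrow> y \<in> P \<Longrightarrow> \<pi> (comm G x y) = comm Q (\<pi> x) (\<pi> y)"
proof -
  interpret N: normal "lcs G P n" "G\<lparr>carrier := P\<rparr>"
    by (rule lcs_normal [OF P])
  have PG: "P \<subseteq> carrier G"
    by (rule subgroup.subset [OF P])
  show Q: "group Q"
    unfolding Q_def by (rule N.factorgroup_is_group)
  show hom: "group_hom (G\<lparr>carrier := P\<rparr>) Q \<pi>"
    using N.r_coset_hom_Mod Q N.is_group
    by (auto simp: group_hom_def group_hom_axioms_def Q_def \<pi>_def)
  interpret h: group_hom "G\<lparr>carrier := P\<rparr>" Q \<pi>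
    by (rule hom)
  show "\<pi> x = \<pi> y \<longleftrightarrow> x \<otimes> inv y \<in> lcs G P n" if "x \<in> P" "y \<in> P" for x y
  proof -
    have G: "x \<in> carrier G" "y \<in> carrier G"
      using that PG by auto
    have "\<pi> x = \<pi> y \<longleftrightarrow> x \<in> lcs G P n #> y"
      using G repr_independence repr_independenceD rcos_self lcs_subgroup [OF P]
      unfolding \<pi>_def by metis
    then show ?thesis
      using subgroup.rcos_module [OF lcs_subgroup [OF P] is_group] G by simp
  qed
  show cl: "\<pi> x \<in> carrier Q" if "x \<in> P" for x
    using h.hom_closed that by simp
  show mult: "\<pi> (x \<otimes> y) = \<pi> x \<otimes>\<^bsub>Q\<^esub> \<pi> y" if "x \<in> P" "y \<in> P" for x y
    using h.hom_mult that by simp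
  show inv: "\<pi> (inv x) = inv\<^bsub>Q\<^esub> (\<pi> x)" if "x \<in> P" for x
    using h.hom_inv that P by simp
  show "\<pi> (x [^] k) = \<pi> x [^]\<^bsub>Q\<^esub> k" if "x \<in> P" for x and k :: nat
    using h.hom_nat_pow [of x k] that by (simp add: nat_pow_consistent [symmetric])
  show "\<pi> (comm G x y) = comm Q (\<pi> x) (\<pi> y)" if "x \<in> P" "y \<in> P" for x y
    using that P by (simp add: comm_def mult inv subgroup.m_closed subgroup.m_inv_closed)
qed

text \<open>The commutators [a, g] die in the quotient, so the image of the term with index n is
  central. This permits (a g)^k = a^k g^k there.\<close>

lemma lcs_quotient_commute:
  assumes P: "subgroup P G" and "a \<in> lcs G P n" "g \<in> P"
  defines "Q \<equiv> G\<lparr>carrier := P\<rparr> Mod lcs G P (Suc n)" and "\<pi> \<equiv> \<lambda>x. lcs G P (Suc n) #> x"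
  shows "\<pi> a \<otimes>\<^bsub>Q\<^esub> \<pi> g = \<pi> g \<otimes>\<^bsub>Q\<^esub> \<pi> a"
proof -
  have a: "a \<in> P"
    using assms lcs_subset by blast
  have G: "a \<in> carrier G" "g \<in> carrier G"
    using a assms subgroup.subset by blast+
  have "a \<otimes> g \<otimes> inv (g \<otimes> a) \<in> lcs G P (Suc n)"
    using comm_in_lcs(1) [OF assms(1-3)] G by (simp add: comm_def inv_mult_group m_assoc)
  then have "\<pi> (a \<otimes> g) = \<pi> (g \<otimes> a)"
    unfolding \<pi>_def using a assms(3) P by (subst lcs_quotient(3)) (auto simp: subgroup.m_closed)
  then show ?thesis
    unfolding \<pi>_def Q_def using a assms(3) P by (simp only: lcs_quotient(5))
qed

text \<open>Induction on the word \<open>g\<close>: the corrections to linearity in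
  \<open>comm_mult_right\<close> and \<open>comm_inv_right\<close> lie two terms further down, hence
  in \<open>T\<close>.\<close>

lemma comm_right_generate:
  assumes H: "subgroup H G" and T: "subgroup T G" and sub: "lcs G H (Suc (Suc n)) \<subseteq> T"
    and a: "a \<in> lcs G H n" and S: "S \<subseteq> H" and gen: "\<And>s. s \<in> S \<Longrightarrow> comm G a s \<in> T"
    and g: "g \<in> generate G S"
  shows "comm G a g \<in> T"
  using g
proof (induction rule: generate.induct)
  have HG: "H \<subseteq> carrier G"
    by (rule subgroup.subset [OF H])
  have aH: "a \<in> H" and aG: "a \<in> carrier G"
    using a lcs_subset [OF H] HG by auto
  {
    case one
    then show ?case
      using aG subgroup.one_closed [OF T] by (simp add: comm_one)
  next
    case (incl h)
    then show ?case by (rule gen)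
  next
    case (inv h)
    have h: "h \<in> H"
      using inv S by auto
    have "comm G (inv h) (inv (comm G a h)) \<in> T"
      using h a by (intro subsetD [OF sub] comm_in_lcs [OF H] subgroup.m_inv_closed [OF H]
          subgroup.m_inv_closed [OF lcs_subgroup [OF H]])
    then show ?case
      using h HG aG gen [OF inv] T
      by (subst comm_inv_right) (auto intro: subgroup.m_closed subgroup.m_inv_closed)
  next
    case (eng g h)
    have gh: "g \<in> H" "h \<in> H"
      using eng generate_subgroup_incl [OF S H] by auto
    have "comm G g (comm G a h) \<in> T"
      using gh a by (intro subsetD [OF sub] comm_in_lcs [OF H])
    then show ?case
      using gh HG aG eng T
      by (subst comm_mult_right) (auto intro!: subgroup.m_closed)
  }
qed

text \<open>The same induction in the first entry, with the corrections from
  \<open>comm_mult_left\<close> and \<open>comm_inv_left\<close>. Here \<open>Y\<close> must stay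
  inside the term with index n so that the nested commutators fall into \<open>T\<close>.\<close>

lemma comm_left_generate:
  assumes H: "subgroup H G" and T: "subgroup T G" and sub: "lcs G H (Suc (Suc n)) \<subseteq> T"
    and Y: "Y \<subseteq> lcs G H n" and g: "g \<in> H" and gen: "\<And>a. a \<in> Y \<Longrightarrow> comm G a g \<in> T"
    and a: "a \<in> generate G Y"
  shows "comm G a g \<in> T"
  using a
proof (induction rule: generate.induct)
  have HG: "H \<subseteq> carrier G" and YH: "Y \<subseteq> H" and gG: "g \<in> carrier G"
    using Y g subgroup.subset [OF H] lcs_subset [OF H] by auto
  {
    case one
    then show ?case
      using gG subgroup.one_closed [OF T] by (simp add: comm_one)
  next
    case (incl h)
    then show ?case by (rule gen)
  next
    case (inv h)
    have h: "h \<in> H" "h \<in> lcs G H n"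
      using inv Y YH by auto
    have "comm G (comm G h g) (inv h) \<in> T"
      using h g by (intro subsetD [OF sub] comm_in_lcs [OF H] subgroup.m_inv_closed [OF H])
    then show ?case
      using h HG gG gen [OF inv] T
      by (subst comm_inv_left) (auto intro: subgroup.m_closed subgroup.m_inv_closed)
  next
    case (eng a b)
    have ab: "a \<in> H" "b \<in> H" "b \<in> lcs G H n"
      using eng generate_subgroup_incl [OF YH H] generate_subgroup_incl [OF Y lcs_subgroup [OF H]]
      by auto
    have "comm G a (comm G b g) \<in> T"
      using ab g by (intro subsetD [OF sub] comm_in_lcs [OF H])
    then show ?case
      using ab HG gG eng T
      by (subst comm_mult_left) (auto intro!: subgroup.m_closed)
  }
qed

text \<open>Reduces a claim about a whole term of the series to commutators [a, s] with
  \<open>s\<close> a generator, provided that the term after it is already under control.\<close>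

lemma lcs_Suc_subset_generated:
  assumes H: "subgroup H G" and T: "subgroup T G" and sub: "lcs G H (Suc (Suc n)) \<subseteq> T"
    and S: "generate G S = H" and gen: "\<And>a s. a \<in> lcs G H n \<Longrightarrow> s \<in> S \<Longrightarrow> comm G a s \<in> T"
  shows "lcs G H (Suc n) \<subseteq> T"
proof -
  have SH: "S \<subseteq> H"
    unfolding S [symmetric] by (rule subsetI) (rule generate.incl)
  have "comm G a g \<in> T" if a: "a \<in> lcs G H n" and g: "g \<in> H" for a g
  proof (rule comm_right_generate [OF H T sub a SH])
    show "comm G a s \<in> T" if "s \<in> S" for s
      by (rule gen [OF a that])
    show "g \<in> generate G S"
      using g by (simp only: S)
  qed
  then have "{comm G a g | a g. a \<in> lcs G H n \<and> g \<in> H} \<subseteq> T"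
    by blast
  then show ?thesis
    unfolding lcs_Suc by (rule generate_subgroup_incl) (rule T)
qed

lemma nat_pow_in_subgroup: "subgroup H G \<Longrightarrow> x \<in> H \<Longrightarrow> x [^] (k::nat) \<in> H"
  by (induction k) (auto intro: subgroup.one_closed subgroup.m_closed)

section \<open>Powers lying in a subgroup\<close>

text \<open>Consecutive terms have an abelian quotient, so a^k = h and b^l = g there give (a b)^(k
  l) = h^l g^k. The witness is required to lie in the term as well as in \<open>H\<close>, so that
  its commutators lie one term lower.\<close>

lemma power_in_subgroup_mod_lcs:
  assumes P: "subgroup P G" and H: "subgroup H G"
  defines "T \<equiv> \<lambda>i. {a \<in> lcs G P i. \<exists>k\<ge>1::nat. \<exists>h\<in>H \<inter> lcs G P i.
    a [^] k \<otimes> inv h \<in> lcs G P (Suc i)}"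
  shows "subgroup (T i) G" "lcs G P (Suc i) \<subseteq> T i"
proof -
  let ?L = "lcs G P i" and ?L' = "lcs G P (Suc i)"
  let ?Q = "G\<lparr>carrier := P\<rparr> Mod ?L'" and ?\<pi> = "\<lambda>x. ?L' #> x"
  note q = lcs_quotient [OF P, where n = "Suc i"]
  interpret Q: group ?Q
    by (rule q(1))
  have LP: "?L \<subseteq> P" and L: "subgroup ?L G" and L': "subgroup ?L' G" and L'L: "?L' \<subseteq> ?L"
    using P by (simp_all only: lcs_subset lcs_subgroup lcs_Suc_subset)
  have PG: "P \<subseteq> carrier G"
    by (rule subgroup.subset [OF P])
  have T_iff: "a \<in> T i \<longleftrightarrow> a \<in> ?L \<and> (\<exists>k\<ge>1::nat. \<exists>h\<in>H \<inter> ?L. ?\<pi> a [^]\<^bsub>?Q\<^esub> k = ?\<pi> h)" for a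
  proof -
    have "a [^] k \<otimes> inv h \<in> ?L' \<longleftrightarrow> ?\<pi> a [^]\<^bsub>?Q\<^esub> k = ?\<pi> h" if "a \<in> ?L" "h \<in> ?L" for k :: nat and h
      using that LP P by (subst q(3) [symmetric]) (auto simp only: q(7) nat_pow_in_subgroup subsetD)
    then show ?thesis
      unfolding T_def by blast
  qed
  show "?L' \<subseteq> T i"
  proof
    fix a assume a: "a \<in> ?L'"
    then have "a \<in> ?L" "a \<in> carrier G"
      using L'L LP PG by blast+
    moreover have "a [^] (1::nat) \<otimes> inv \<one> \<in> ?L'" "\<one> \<in> H \<inter> ?L"
      using a \<open>a \<in> carrier G\<close> by (simp_all del: lcs.simps add: subgroup.one_closed L H)
    ultimately show "a \<in> T i"
      unfolding T_def by blast
  qed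
  show "subgroup (T i) G"
  proof (rule subgroupI)
    show "T i \<subseteq> carrier G"
      using LP PG by (auto simp: T_def)
    show "T i \<noteq> {}"
      using \<open>?L' \<subseteq> T i\<close> subgroup.one_closed [OF L'] by blast
  next
    fix a assume "a \<in> T i"
    then obtain k h where a: "a \<in> ?L" "a \<in> P" and k: "k \<ge> (1::nat)" and h: "h \<in> H \<inter> ?L" "h \<in> P"
      and eq: "?\<pi> a [^]\<^bsub>?Q\<^esub> k = ?\<pi> h"
      using LP unfolding T_iff by blast
    have "?\<pi> (inv a) [^]\<^bsub>?Q\<^esub> k = ?\<pi> (inv h)"
      using a h eq by (simp only: q(4,6) Q.nat_pow_inv)
    moreover have "inv a \<in> ?L" "inv h \<in> H \<inter> ?L"
      using a h H L by (auto intro: subgroup.m_inv_closed)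
    ultimately show "inv a \<in> T i"
      unfolding T_iff using k by blast
  next
    fix a b assume "a \<in> T i" "b \<in> T i"
    then obtain k h l g where a: "a \<in> ?L" "a \<in> P" and b: "b \<in> ?L" "b \<in> P"
      and k: "k \<ge> (1::nat)" and l: "l \<ge> (1::nat)"
      and h: "h \<in> H \<inter> ?L" "h \<in> P" and g: "g \<in> H \<inter> ?L" "g \<in> P"
      and eq: "?\<pi> a [^]\<^bsub>?Q\<^esub> k = ?\<pi> h" "?\<pi> b [^]\<^bsub>?Q\<^esub> l = ?\<pi> g"
      using LP unfolding T_iff by blast
    have "?\<pi> (a \<otimes> b) [^]\<^bsub>?Q\<^esub> (k * l) = (?\<pi> a [^]\<^bsub>?Q\<^esub> k) [^]\<^bsub>?Q\<^esub> l \<otimes>\<^bsub>?Q\<^esub> (?\<pi> b [^]\<^bsub>?Q\<^esub> l) [^]\<^bsub>?Q\<^esub> k"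
      using a b by (simp only: q(4,5) Q.pow_mult_distrib [OF lcs_quotient_commute [OF P a(1) b(2)]]
          Q.nat_pow_pow mult.commute [of l k])
    also have "\<dots> = ?\<pi> (h [^] l \<otimes> g [^] k)"
      using h g P unfolding eq by (simp only: q(4,5,7) nat_pow_in_subgroup)
    finally have "?\<pi> (a \<otimes> b) [^]\<^bsub>?Q\<^esub> (k * l) = ?\<pi> (h [^] l \<otimes> g [^] k)" .
    moreover have "a \<otimes> b \<in> ?L" "h [^] l \<otimes> g [^] k \<in> H \<inter> ?L"
      using a b h g H L by (auto intro!: subgroup.m_closed nat_pow_in_subgroup)
    moreover have "k * l \<ge> 1"
      using k l by simp
    ultimately show "a \<otimes> b \<in> T i"
      unfolding T_iff by blast
  qed
qed

text \<open>By bilinearity, if a^k is congruent to h in \<open>H\<close> and s^l lies in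
  \<open>H\<close>, then [a, s]^(k l) is congruent to [h, s^l], an element of \<open>H\<close>,
  modulo the term after the one containing [a, s]. Such commutators suffice by
  \<open>lcs_Suc_subset_generated\<close>.\<close>

lemma lcs_power_in_subgroup:
  assumes P: "subgroup P G" and H: "subgroup H G" and S: "generate G S = P"
    and pow: "\<And>s. s \<in> S \<Longrightarrow> \<exists>k\<ge>1::nat. s [^] k \<in> H"
    and HP: "H \<subseteq> P"
  shows "a \<in> lcs G P i \<Longrightarrow>
    \<exists>k\<ge>1::nat. \<exists>h\<in>H \<inter> lcs G P i. a [^] k \<otimes> inv h \<in> lcs G P (Suc i)"
proof (induction i arbitrary: a)
  let ?T = "\<lambda>i. {a \<in> lcs G P i. \<exists>k\<ge>1::nat. \<exists>h\<in>H \<inter> lcs G P i.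
    a [^] k \<otimes> inv h \<in> lcs G P (Suc i)}"
  note T = power_in_subgroup_mod_lcs [OF P H]
  have SP: "S \<subseteq> P"
    unfolding S [symmetric] by (rule subsetI) (rule generate.incl)
  have PG: "P \<subseteq> carrier G"
    by (rule subgroup.subset [OF P])
  {
    case 0
    have "s \<in> ?T 0" if "s \<in> S" for s
    proof -
      obtain k where "k \<ge> (1::nat)" "s [^] k \<in> H"
        using pow \<open>s \<in> S\<close> by blast
      moreover have "s \<in> P" "s \<in> carrier G"
        using that SP PG by auto
      ultimately have "s \<in> lcs G P 0" "s [^] k \<in> H \<inter> lcs G P 0"
        "s [^] k \<otimes> inv (s [^] k) \<in> lcs G P (Suc 0)"
        using subgroup.one_closed [OF lcs_subgroup [OF P, of "Suc 0"]] HP by (auto simp del: lcs.simps(2))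
      then show ?thesis
        using \<open>k \<ge> 1\<close> by blast
    qed
    then have "generate G S \<subseteq> ?T 0"
      by (intro generate_subgroup_incl T(1)) blast
    then show ?case
      using 0 unfolding S lcs.simps(1) by blast
  next
    case (Suc i)
    let ?L' = "lcs G P (Suc i)" and ?L'' = "lcs G P (Suc (Suc i))"
    let ?Q = "G\<lparr>carrier := P\<rparr> Mod ?L''" and ?\<pi> = "\<lambda>x. ?L'' #> x"
    note q = lcs_quotient [OF P, where n = "Suc (Suc i)"]
    interpret Q: group ?Q
      by (rule q(1))
    have LP: "lcs G P i \<subseteq> P" "?L' \<subseteq> P"
      using P by (simp_all only: lcs_subset)
    have "comm G a s \<in> ?T (Suc i)" if a: "a \<in> lcs G P i" and s: "s \<in> S" for a s
    proof -
      obtain k h where k: "k \<ge> (1::nat)" and h: "h \<in> H \<inter> lcs G P i"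
        and c: "a [^] k \<otimes> inv h \<in> ?L'"
        using Suc.IH [OF a] by blast
      obtain l where l: "l \<ge> (1::nat)" "s [^] l \<in> H"
        using pow s by blast
      define c where "c = a [^] k \<otimes> inv h"
      have cL: "c \<in> ?L'" "c \<in> P"
        using c LP unfolding c_def by blast+
      have aP: "a \<in> P" "a [^] k \<in> P" and sP: "s \<in> P" "s [^] l \<in> P" and hP: "h \<in> P"
        using a s h LP SP by (auto intro!: nat_pow_in_subgroup [OF P])
      have ak: "a [^] k = c \<otimes> h"
        using aP hP PG unfolding c_def by (simp add: m_assoc subset_iff)
      have as: "comm G a s \<in> ?L'" "comm G a s \<in> P"
        using comm_in_lcs(1) [OF P a sP(1)] LP by blast+
      have ahs: "comm G a (s [^] l) \<in> ?L'" "comm G a (s [^] l) \<in> P"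
        using comm_in_lcs(1) [OF P a sP(2)] LP by blast+
      have hs: "comm G h (s [^] l) \<in> H \<inter> ?L'" "comm G h (s [^] l) \<in> P"
        using comm_in_lcs(1) [OF P _ sP(2), of h] h LP comm_in_subgroup [OF H _ l(2)] by blast+
      have central: "?\<pi> x \<otimes>\<^bsub>?Q\<^esub> ?\<pi> g = ?\<pi> g \<otimes>\<^bsub>?Q\<^esub> ?\<pi> x" if "x \<in> ?L'" "g \<in> P" for x g
        by (rule lcs_quotient_commute [OF P that])
      have qc: "?\<pi> c \<in> carrier ?Q" "?\<pi> h \<in> carrier ?Q" "?\<pi> s \<in> carrier ?Q" "?\<pi> a \<in> carrier ?Q"
        "?\<pi> (s [^] l) \<in> carrier ?Q"
        using cL hP sP aP by (simp_all only: q(4))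
      have "(?\<pi> (comm G a s) [^]\<^bsub>?Q\<^esub> l) [^]\<^bsub>?Q\<^esub> k = comm ?Q (?\<pi> a) (?\<pi> s [^]\<^bsub>?Q\<^esub> l) [^]\<^bsub>?Q\<^esub> k"
        using central [OF as(1) sP(1)] qc aP sP by (simp only: q(8) Q.comm_pow_right)
      also have "\<dots> = comm ?Q (?\<pi> a [^]\<^bsub>?Q\<^esub> k) (?\<pi> s [^]\<^bsub>?Q\<^esub> l)"
        using central [OF ahs(1) aP(1)] qc aP sP
        by (simp only: q(7,8) Q.comm_pow_left Q.nat_pow_closed)
      also have "\<dots> = comm ?Q (?\<pi> c \<otimes>\<^bsub>?Q\<^esub> ?\<pi> h) (?\<pi> (s [^] l))"
        using aP sP cL hP by (simp only: q(5,7) [symmetric] ak)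
      \<comment> \<open>The error \<open>c\<close> lies one term below \<open>h\<close> and is
        central modulo \<open>?L''\<close>, so both factors of \<open>comm_mult_left\<close> that
        contain it are trivial.\<close>
      also have "\<dots> = comm ?Q (?\<pi> h) (?\<pi> (s [^] l))"
      proof -
        have "?\<pi> c \<otimes>\<^bsub>?Q\<^esub> comm ?Q (?\<pi> h) (?\<pi> (s [^] l)) = comm ?Q (?\<pi> h) (?\<pi> (s [^] l)) \<otimes>\<^bsub>?Q\<^esub> ?\<pi> c"
          using central [OF cL(1) hs(2)] hP sP by (simp only: q(8))
        then have "comm ?Q (?\<pi> c) (comm ?Q (?\<pi> h) (?\<pi> (s [^] l))) = \<one>\<^bsub>?Q\<^esub>"
          using qc by (subst Q.comm_eq_one_iff) (simp_all only: Q.comm_closed)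
        moreover have "comm ?Q (?\<pi> c) (?\<pi> (s [^] l)) = \<one>\<^bsub>?Q\<^esub>"
          using qc central [OF cL(1) sP(2)] by (subst Q.comm_eq_one_iff)
        ultimately show ?thesis
          using qc by (simp only: Q.comm_mult_left Q.comm_closed Q.l_one Q.r_one)
      qed
      also have "\<dots> = ?\<pi> (comm G h (s [^] l))"
        using hP sP by (simp only: q(8))
      finally have "?\<pi> (comm G a s [^] (l * k)) = ?\<pi> (comm G h (s [^] l))"
        using as P by (simp only: q(7) q(4) Q.nat_pow_pow)
      then have "comm G a s [^] (l * k) \<otimes> inv (comm G h (s [^] l)) \<in> ?L''"
        using as hs P by (subst q(3) [symmetric]) (simp_all only: nat_pow_in_subgroup)
      moreover have "l * k \<ge> 1"
        using k l by simp
      ultimately show ?thesis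
        using as hs by blast
    qed
    then have "?L' \<subseteq> ?T (Suc i)"
      by (intro lcs_Suc_subset_generated [OF P T(1) T(2) S])
    then show ?case
      using Suc.prems by blast
  }
qed

text \<open>Descent along the series: let g^k = c h with h in \<open>H\<close> and c in the term
  with index i. Some c^l agrees with an element of \<open>H\<close> modulo the next term, where c is
  central, so g^(k l) = c^l h^l also lies in \<open>H\<close> up to that term. At index n the error
  is gone.\<close>

theorem power_in_subgroup_of_generators:
  assumes P: "subgroup P G" and nil: "lcs G P n = {\<one>}" and S: "generate G S = P"
    and H: "subgroup H G" and pow: "\<And>s. s \<in> S \<Longrightarrow> \<exists>k\<ge>1::nat. s [^] k \<in> H"
    and g: "g \<in> P"
  shows "\<exists>k\<ge>1::nat. g [^] k \<in> H"
proof -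
  \<comment> \<open>\<open>H\<close> may reach outside \<open>P\<close>, but powers of elements of
    \<open>P\<close> stay in \<open>P\<close>, so the intersection satisfies the same condition on
    generators.\<close>
  let ?H = "H \<inter> P"
  have H': "subgroup ?H G"
    using subgroups_Inter_pair [OF H P] .
  have PG: "P \<subseteq> carrier G"
    by (rule subgroup.subset [OF P])
  have pow': "\<exists>k\<ge>1::nat. s [^] k \<in> ?H" if "s \<in> S" for s
    using pow [OF that] that generate.incl [of s S G] nat_pow_in_subgroup [OF P] unfolding S by blast
  have "\<exists>k\<ge>1::nat. \<exists>h\<in>?H. g [^] k \<otimes> inv h \<in> lcs G P i" for i
  proof (induction i)
    case 0
    have "g [^] (1::nat) \<otimes> inv \<one> \<in> lcs G P 0" "\<one> \<in> ?H"
      using g PG subgroup.one_closed [OF H'] by (auto simp: subset_iff)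
    then show ?case
      by blast
  next
    case (Suc i)
    let ?L = "lcs G P i" and ?L' = "lcs G P (Suc i)"
    let ?Q = "G\<lparr>carrier := P\<rparr> Mod ?L'" and ?\<pi> = "\<lambda>x. ?L' #> x"
    note q = lcs_quotient [OF P, where n = "Suc i"]
    interpret Q: group ?Q
      by (rule q(1))
    have LP: "?L \<subseteq> P"
      using P by (simp only: lcs_subset)
    from Suc obtain k h where k: "k \<ge> (1::nat)" and h: "h \<in> ?H" and c: "g [^] k \<otimes> inv h \<in> ?L"
      by blast
    define c where "c = g [^] k \<otimes> inv h"
    obtain l h' where l: "l \<ge> (1::nat)" and h': "h' \<in> ?H" and c': "c [^] l \<otimes> inv h' \<in> ?L'"
      using lcs_power_in_subgroup [OF P H' S pow' Int_lower2 c] unfolding c_def by blast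
    have cP: "c \<in> ?L" "c \<in> P" and gP: "g [^] k \<in> P" "g [^] (k * l) \<in> P"
      and hP: "h \<in> P" "h' \<in> P" "h' \<otimes> h [^] l \<in> P" "h [^] l \<in> P" "c [^] l \<in> P"
      using c LP g h h' P unfolding c_def
      by (auto intro!: nat_pow_in_subgroup subgroup.m_closed subgroup.m_inv_closed)
    have gk: "g [^] k = c \<otimes> h"
      using gP hP PG unfolding c_def by (simp add: m_assoc subset_iff)
    have "g [^] (k * l) = (c \<otimes> h) [^] l"
      using g PG by (simp add: nat_pow_pow gk [symmetric] subset_iff)
    then have "?\<pi> (g [^] (k * l)) = (?\<pi> c \<otimes>\<^bsub>?Q\<^esub> ?\<pi> h) [^]\<^bsub>?Q\<^esub> l"
      using gP cP hP by (simp only: q(5,7) gk)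
    also have "\<dots> = ?\<pi> (c [^] l) \<otimes>\<^bsub>?Q\<^esub> ?\<pi> (h [^] l)"
      using cP hP
      by (simp only: Q.pow_mult_distrib [OF lcs_quotient_commute [OF P cP(1) hP(1)]] q(4,7))
    also have "?\<pi> (c [^] l) = ?\<pi> h'"
      using c' hP by (subst q(3))
    also have "?\<pi> h' \<otimes>\<^bsub>?Q\<^esub> ?\<pi> (h [^] l) = ?\<pi> (h' \<otimes> h [^] l)"
      using hP by (simp only: q(5))
    finally have "g [^] (k * l) \<otimes> inv (h' \<otimes> h [^] l) \<in> ?L'"
      using gP hP by (simp only: q(3))
    moreover have "h' \<otimes> h [^] l \<in> ?H" "k * l \<ge> 1"
      using h h' k l subgroup.m_closed [OF H'] nat_pow_in_subgroup [OF H'] by auto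
    ultimately show ?case
      by blast
  qed
  from this [of n] obtain k h where k: "k \<ge> (1::nat)" and h: "h \<in> ?H" and eq: "g [^] k \<otimes> inv h = \<one>"
    unfolding nil by blast
  have "g \<in> carrier G" "h \<in> carrier G"
    using g h PG by auto
  then have "g [^] k = h"
    using eq inv_solve_right' [of \<one> "g [^] k" h] by simp
  then show ?thesis
    using k h by blast
qed

section \<open>Finite index\<close>

text \<open>Every element of the larger group has the form a x^e. Since x^k lies in
  \<open>H\<close>, only the remainders of e modulo k contribute new cosets, so the representatives
  f x^r with r < k are enough.\<close>

lemma finite_cover_insert:
  assumes P: "subgroup P G" and H: "subgroup H G" and A: "subgroup A G" and AP: "A \<subseteq> P"
    and norm: "\<And>g a. g \<in> P \<Longrightarrow> a \<in> A \<Longrightarrow> g \<otimes> a \<otimes> inv g \<in> A"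
    and x: "x \<in> P" and k: "k \<ge> (1::nat)" "x [^] k \<in> H"
    and F: "finite F" "F \<subseteq> carrier G" "A \<subseteq> (\<Union>f\<in>F. H #> f)"
  shows "\<exists>F. finite F \<and> F \<subseteq> carrier G \<and> generate G (insert x A) \<subseteq> (\<Union>f\<in>F. H #> f)"
proof -
  have PG: "P \<subseteq> carrier G"
    by (rule subgroup.subset [OF P])
  have xG: "x \<in> carrier G"
    using x PG by auto
  have AG: "a \<in> carrier G" if "a \<in> A" for a
    using that AP PG by auto
  have xe: "x [^] e \<in> P" for e :: int
    by (rule subgroup_int_pow_closed [OF P x])
  \<comment> \<open>Because powers of x normalise \<open>A\<close>, these products already form a
    subgroup. Integer exponents make it closed under inverses.\<close>
  let ?C = "{a \<otimes> x [^] e | a (e::int). a \<in> A}"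
  have C: "subgroup ?C G"
  proof (rule subgroupI)
    show "?C \<subseteq> carrier G"
      using AG xG by auto
    show "?C \<noteq> {}"
      using subgroup.one_closed [OF A] by blast
  next
    fix c assume "c \<in> ?C"
    then obtain a and e :: int where a: "a \<in> A" and c: "c = a \<otimes> x [^] e"
      by blast
    have "inv c = (x [^] (- e) \<otimes> inv a \<otimes> inv (x [^] (- e))) \<otimes> x [^] (- e)"
      using AG [OF a] xG unfolding c by (simp add: inv_mult_group m_assoc int_pow_neg)
    then show "inv c \<in> ?C"
      using norm [OF xe [of "- e"] subgroup.m_inv_closed [OF A a]] by blast
  next
    fix c d assume "c \<in> ?C" "d \<in> ?C"
    then obtain a b and e i :: int where a: "a \<in> A" and c: "c = a \<otimes> x [^] e"
      and b: "b \<in> A" and d: "d = b \<otimes> x [^] i"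
      by blast
    have "c \<otimes> d = (a \<otimes> (x [^] e \<otimes> b \<otimes> inv (x [^] e))) \<otimes> x [^] (e + i)"
      using AG [OF a] AG [OF b] xG unfolding c d by (simp add: m_assoc int_pow_mult)
    then show "c \<otimes> d \<in> ?C"
      using subgroup.m_closed [OF A a norm [OF xe [of e] b]] by blast
  qed
  have "x \<in> ?C"
  proof -
    have "x = \<one> \<otimes> x [^] (1::int)"
      using xG by simp
    then show ?thesis
      using subgroup.one_closed [OF A] by blast
  qed
  moreover have "A \<subseteq> ?C"
  proof
    fix a assume "a \<in> A"
    moreover have "a = a \<otimes> x [^] (0::int)"
      using AG [OF \<open>a \<in> A\<close>] by simp
    ultimately show "a \<in> ?C"
      by blast
  qed
  ultimately have gen: "generate G (insert x A) \<subseteq> ?C"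
    by (intro generate_subgroup_incl C) blast
  let ?F = "(\<lambda>(f, r). f \<otimes> x [^] r) ` (F \<times> {..<k})"
  have "?C \<subseteq> (\<Union>f\<in>?F. H #> f)"
  proof
    fix c assume "c \<in> ?C"
    then obtain a and e :: int where a: "a \<in> A" and c: "c = a \<otimes> x [^] e"
      by blast
    define r where "r = nat (e mod int k)"
    define y where "y = x [^] (int k * (e div int k))"
    have r: "r < k"
      using k(1) unfolding r_def by (simp add: nat_less_iff)
    have e: "e = int k * (e div int k) + int r"
      using k(1) unfolding r_def by simp
    have "x [^] e = y \<otimes> x [^] r"
      unfolding y_def int_pow_int [symmetric] int_pow_mult [OF xG, symmetric] using e by simp
    have yG: "y \<in> carrier G" "y \<in> P"
      using xG xe unfolding y_def by auto
    have yH: "y \<in> H"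
      using subgroup_int_pow_closed [OF H k(2)] xG unfolding y_def
      by (metis int_pow_int int_pow_pow)
    \<comment> \<open>The part \<open>y\<close> of x^e that lies in \<open>H\<close> is moved to the
      left of \<open>a\<close>. This replaces \<open>a\<close> by a conjugate, which remains in
      \<open>A\<close> and is covered by \<open>F\<close>.\<close>
    have "inv y \<otimes> a \<otimes> inv (inv y) \<in> A"
      using norm a yG subgroup.m_inv_closed [OF P] by blast
    then obtain f h where f: "f \<in> F" and h: "h \<in> H" and "inv y \<otimes> a \<otimes> y = h \<otimes> f"
      using F(3) yG(1) unfolding r_coset_def by auto
    then have "c = y \<otimes> (h \<otimes> f) \<otimes> x [^] r"
      using AG [OF a] yG xG \<open>x [^] e = y \<otimes> x [^] r\<close> unfolding c by (simp add: m_assoc flip: \<open>inv y \<otimes> a \<otimes> y = h \<otimes> f\<close>)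
    also have "\<dots> = (y \<otimes> h) \<otimes> (f \<otimes> x [^] r)"
      using yG xG f h F(2) subgroup.mem_carrier [OF H] by (simp add: m_assoc subset_iff)
    finally have "c \<in> H #> (f \<otimes> x [^] r)"
      using subgroup.m_closed [OF H yH h] unfolding r_coset_def by blast
    then show "c \<in> (\<Union>f\<in>?F. H #> f)"
      using f r by force
  qed
  moreover have "finite ?F" "?F \<subseteq> carrier G"
    using F xG by auto
  ultimately show ?thesis
    using gen by (intro exI [of _ ?F]) (simp del: UN_simps)
qed

text \<open>If \<open>Y\<close> generates a term modulo the next one, the commutators [y, s]
  generate the next term modulo its successor: the second entry is reduced to \<open>S\<close>, then
  the first to \<open>Y\<close> and the next term, whose commutators fall into the
  successor.\<close>

lemma lcs_finitely_generated_mod: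
  assumes P: "subgroup P G" and S: "generate G S = P" and fin: "finite S"
  shows "\<exists>Y. finite Y \<and> Y \<subseteq> lcs G P i \<and> lcs G P i \<subseteq> generate G (Y \<union> lcs G P (Suc i))"
proof (induction i)
  case 0
  have "S \<subseteq> P"
    unfolding S [symmetric] by (rule subsetI) (rule generate.incl)
  moreover have "P \<subseteq> generate G (S \<union> lcs G P (Suc 0))"
    unfolding S [symmetric] by (rule mono_generate) blast
  ultimately show ?case
    using fin by (intro exI [of _ S]) simp
next
  case (Suc i)
  then obtain Y where Y: "finite Y" "Y \<subseteq> lcs G P i" "lcs G P i \<subseteq> generate G (Y \<union> lcs G P (Suc i))"
    by blast
  let ?L' = "lcs G P (Suc i)" and ?L'' = "lcs G P (Suc (Suc i))"
  let ?Z = "(\<lambda>(a, s). comm G a s) ` (Y \<times> S)"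
  let ?T = "generate G (?Z \<union> ?L'')"
  have SP: "S \<subseteq> P"
    unfolding S [symmetric] by (rule subsetI) (rule generate.incl)
  have ZL: "?Z \<subseteq> ?L'"
    using Y(2) SP comm_in_lcs(1) [OF P] by (auto simp only: subset_iff)
  have L'': "?L'' \<subseteq> ?L'" and L': "?L' \<subseteq> lcs G P i" and LG: "?L' \<subseteq> carrier G"
    using P by (simp_all only: lcs_Suc_subset subgroup.subset lcs_subgroup)
  have T: "subgroup ?T G"
    using ZL L'' LG by (intro generate_is_subgroup) blast
  have L''T: "?L'' \<subseteq> ?T"
    by (rule subsetI) (rule generate.incl, simp del: lcs.simps)
  have "comm G a s \<in> ?T" if a: "a \<in> lcs G P i" and s: "s \<in> S" for a s
  proof (rule comm_left_generate [OF P T L''T])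
    show "Y \<union> ?L' \<subseteq> lcs G P i"
      using Y(2) L' by blast
    show "s \<in> P"
      using s SP by blast
    show "a \<in> generate G (Y \<union> ?L')"
      using a Y(3) by blast
    show "comm G b s \<in> ?T" if "b \<in> Y \<union> ?L'" for b
    proof (rule generate.incl)
      show "comm G b s \<in> ?Z \<union> ?L''"
        using that s SP comm_in_lcs(1) [OF P, of b "Suc i" s] by blast
    qed
  qed
  then have "?L' \<subseteq> ?T"
    by (rule lcs_Suc_subset_generated [OF P T L''T S])
  then show ?case
    using Y(1) fin ZL by (intro exI [of _ ?Z]) blast
qed

text \<open>Each term arises from the next by adjoining finitely many elements, each with a power in
  \<open>H\<close>, and \<open>finite_cover_insert\<close> handles one at a time. Covers by cosets
  make sense for terms that do not contain \<open>H\<close>.\<close>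

theorem finite_cover_of_power_in_subgroup:
  assumes P: "subgroup P G" and nil: "lcs G P n = {\<one>}" and S: "generate G S = P" "finite S"
    and H: "subgroup H G" and pow: "\<And>g. g \<in> P \<Longrightarrow> \<exists>k\<ge>1::nat. g [^] k \<in> H"
  shows "\<exists>F. finite F \<and> F \<subseteq> carrier G \<and> P \<subseteq> (\<Union>f\<in>F. H #> f)"
proof -
  let ?cov = "\<lambda>A. \<exists>F. finite F \<and> F \<subseteq> carrier G \<and> A \<subseteq> (\<Union>f\<in>F. H #> f)"
  have mono: "?cov A" if "?cov B" "A \<subseteq> B" for A B
    using that by (meson subset_trans)
  have PG: "P \<subseteq> carrier G"
    by (rule subgroup.subset [OF P])
  have "?cov (lcs G P i)" if "i \<le> n" for i
    using that
  \<comment> \<open>The induction starts at the trivial term with index n and ends at index 0, which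
    is \<open>P\<close>.\<close>
  proof (induction rule: inc_induct)
    case base
    have "lcs G P n \<subseteq> H #> \<one>"
      using nil subgroup.one_closed [OF H] by (force simp: r_coset_def)
    then show ?case
      by (intro exI [of _ "{\<one>}"]) simp
  next
    case (step i)
    let ?L = "lcs G P i" and ?L' = "lcs G P (Suc i)"
    have LP: "?L \<subseteq> P" and L: "subgroup ?L G" and L'L: "?L' \<subseteq> ?L"
      using P by (simp_all only: lcs_subset lcs_subgroup lcs_Suc_subset)
    obtain Y where Y: "finite Y" "Y \<subseteq> ?L" "?L \<subseteq> generate G (Y \<union> ?L')"
      using lcs_finitely_generated_mod [OF P S] by blast
    have "?cov (generate G (Y \<union> ?L'))"
      using Y(1,2)
    proof (induction Y rule: finite_induct)
      case empty
      have "generate G ({} \<union> ?L') \<subseteq> ?L'"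
        by (intro generate_subgroup_incl lcs_subgroup P) simp
      then show ?case
        by (rule mono [OF step.IH])
    next
      case (insert y Y)
      let ?A = "generate G (Y \<union> ?L')"
      have AL: "?A \<subseteq> ?L"
        using insert.prems L'L by (intro generate_subgroup_incl L) blast
      have A: "subgroup ?A G"
        using insert.prems L'L LP PG by (intro generate_is_subgroup) blast
      have y: "y \<in> P"
        using insert.prems LP by blast
      \<comment> \<open>Conjugation by \<open>g\<close> multiplies \<open>a\<close> by a commutator
        in \<open>?L'\<close>, and \<open>?A\<close> contains \<open>?L'\<close>.\<close>
      have norm: "g \<otimes> a \<otimes> inv g \<in> ?A" if "g \<in> P" "a \<in> ?A" for g a
      proof -
        have "a \<in> ?L" "a \<in> carrier G" "g \<in> carrier G"
          using that AL LP PG by blast+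
        moreover have "comm G g a \<in> ?A"
          using comm_in_lcs(2) [OF P \<open>a \<in> ?L\<close> that(1)] by (blast intro: generate.incl)
        ultimately show ?thesis
          using that subgroup.m_closed [OF A] by (simp only: conj_eq_comm)
      qed
      obtain k where k: "k \<ge> (1::nat)" "y [^] k \<in> H"
        using pow [OF y] by blast
      obtain F where F: "finite F" "F \<subseteq> carrier G" "?A \<subseteq> (\<Union>f\<in>F. H #> f)"
        using insert.IH insert.prems by blast
      have "?A \<subseteq> P"
        using AL LP by blast
      then have "?cov (generate G (insert y ?A))"
        by (rule finite_cover_insert [OF P H A _ norm y k F])
      moreover have "generate G (insert y Y \<union> ?L') \<subseteq> generate G (insert y ?A)"
        by (rule mono_generate) (auto intro: generate.incl simp del: lcs.simps)
      ultimately show ?case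
        by (rule mono)
    qed
    then show ?case
      using Y(3) by (rule mono)
  qed
  from this [of 0] show ?thesis
    by simp
qed

section \<open>Finite index and powers\<close>

lemma finite_index_subgroup_restrict:
  assumes "subgroup H G" "subgroup P G"
  shows "finite_index_subgroup H (G\<lparr>carrier := P\<rparr>) \<longleftrightarrow> H \<subseteq> P \<and> finite ((\<lambda>a. H #> a) ` P)"
proof -
  have "rcosets\<^bsub>G\<lparr>carrier := P\<rparr>\<^esub> H = (\<lambda>a. H #> a) ` P"
    by (auto simp: RCOSETS_def)
  then show ?thesis
    using assms subgroup_incl [of H P] subgroup.subset [of H "G\<lparr>carrier := P\<rparr>"]
    unfolding finite_index_subgroup_def by auto
qed

text \<open>The main criterion for finite index in the transfer argument: the cosets of a finite
  cover exhaust all cosets of elements of \<open>P\<close>.\<close>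

lemma finite_index_subgroupI:
  assumes P: "subgroup P G" and nil: "lcs G P n = {\<one>}" and S: "generate G S = P" "finite S"
    and H: "subgroup H G" "H \<subseteq> P" and pow: "\<And>g. g \<in> P \<Longrightarrow> \<exists>k\<ge>1::nat. g [^] k \<in> H"
  shows "finite_index_subgroup H (G\<lparr>carrier := P\<rparr>)"
proof -
  obtain F where F: "finite F" "F \<subseteq> carrier G" "P \<subseteq> (\<Union>f\<in>F. H #> f)"
    using finite_cover_of_power_in_subgroup [OF P nil S H(1) pow] by blast
  have "(\<lambda>a. H #> a) ` P \<subseteq> (\<lambda>a. H #> a) ` F"
  proof (rule image_subsetI)
    fix a assume "a \<in> P"
    then obtain f where f: "f \<in> F" "a \<in> H #> f"
      using F(3) by auto
    then have "H #> f = H #> a"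
      using F(2) by (intro repr_independence [OF _ _ H(1)]) auto
    then show "H #> a \<in> (\<lambda>a. H #> a) ` F"
      using f(1) by auto
  qed
  then have "finite ((\<lambda>a. H #> a) ` P)"
    by (rule finite_subset) (rule finite_imageI [OF F(1)])
  then show ?thesis
    using H P by (simp add: finite_index_subgroup_restrict)
qed

text \<open>Pigeonhole: with r cosets, two of the r + 1 powers x^0, ..., x^r share a coset, so some
  x^d with 1 \<le> d \<le> r lies in \<open>H\<close>. As d divides r!, the exponent r! serves all x
  at once, even if \<open>H\<close> is not normal.\<close>

lemma finite_index_subgroup_uniform_power:
  assumes P: "subgroup P G" and H: "finite_index_subgroup H (G\<lparr>carrier := P\<rparr>)"
  shows "\<exists>m\<ge>1::nat. \<forall>x\<in>P. x [^] m \<in> H"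
proof -
  have HG: "subgroup H G"
    using H incl_subgroup [OF P] by (simp add: finite_index_subgroup_def)
  then have fin: "finite ((\<lambda>a. H #> a) ` P)"
    using H P by (simp add: finite_index_subgroup_restrict)
  define r where "r = card ((\<lambda>a. H #> a) ` P)"
  have "x [^] (fact r :: nat) \<in> H" if x: "x \<in> P" for x
  proof -
    have xG: "x \<in> carrier G"
      using x subgroup.subset [OF P] by auto
    let ?f = "\<lambda>i::nat. H #> x [^] i"
    have "?f ` {..r} \<subseteq> (\<lambda>a. H #> a) ` P"
      using nat_pow_in_subgroup [OF P x] by auto
    then have "card (?f ` {..r}) \<le> r"
      unfolding r_def by (intro card_mono fin)
    then have "\<not> inj_on ?f {..r}"
      by (auto dest: card_image)
    then obtain i j where "i < j" "j \<le> r" and eq: "?f i = ?f j"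
      by (auto simp: inj_on_def) (metis linorder_neqE_nat)
    have "x [^] j \<in> H #> x [^] i"
      using eq xG by (auto intro: repr_independenceD [OF HG])
    then have "x [^] j \<otimes> inv (x [^] i) \<in> H"
      using subgroup.rcos_module [OF HG is_group] xG by simp
    moreover have "x [^] j = x [^] (j - i) \<otimes> x [^] i"
      using nat_pow_mult [OF xG] \<open>i < j\<close> by simp
    ultimately have "x [^] (j - i) \<in> H"
      using xG by (simp add: m_assoc)
    moreover have "j - i dvd (fact r :: nat)"
      using \<open>i < j\<close> \<open>j \<le> r\<close> by (intro dvd_fact) auto
    ultimately show ?thesis
      using xG nat_pow_in_subgroup [OF HG] by (metis dvdE nat_pow_pow)
  qed
  moreover have "(fact r :: nat) \<ge> 1"
    by simp
  ultimately show ?thesis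
    by blast
qed

section \<open>Subgroups consisting of powers\<close>

text \<open>The m-th powers need not form a subgroup, so they serve as generators. Enough iterations
  yield a subgroup consisting of genuine m-th powers.\<close>

definition pow_subgroup :: "nat \<Rightarrow> 'a set \<Rightarrow> 'a set" where
  "pow_subgroup m H = generate G ((\<lambda>x. x [^] m) ` H)"

lemma pow_subgroup:
  assumes "subgroup H G"
  shows "subgroup (pow_subgroup m H) G" "pow_subgroup m H \<subseteq> H"
proof -
  have "(\<lambda>x. x [^] m) ` H \<subseteq> H"
    using nat_pow_in_subgroup [OF assms] by blast
  then show "subgroup (pow_subgroup m H) G" "pow_subgroup m H \<subseteq> H"
    unfolding pow_subgroup_def using subgroup.subset [OF assms]
    by (blast intro: generate_is_subgroup, intro generate_subgroup_incl assms)
qed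

lemma funpow_pow_subgroup:
  assumes H: "subgroup H G"
  shows "subgroup ((pow_subgroup m ^^ j) H) G"
    and "x \<in> H \<Longrightarrow> x [^] (m ^ j) \<in> (pow_subgroup m ^^ j) H"
proof -
  show sub: "subgroup ((pow_subgroup m ^^ j) H) G" for j
    by (induction j) (auto intro: H pow_subgroup)
  assume x: "x \<in> H"
  then have xG: "x \<in> carrier G"
    using subgroup.mem_carrier [OF H] by blast
  show "x [^] (m ^ j) \<in> (pow_subgroup m ^^ j) H"
  proof (induction j)
    case (Suc j)
    have "(x [^] (m ^ j)) [^] m \<in> pow_subgroup m ((pow_subgroup m ^^ j) H)"
      unfolding pow_subgroup_def [of m "(pow_subgroup m ^^ j) H"]
      using Suc by (intro generate.incl imageI)
    then show ?case
      using xG by (simp add: nat_pow_pow mult.commute)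
  qed (use x xG in simp)
qed

text \<open>On the abelian quotient of consecutive terms, raising to the m-th power is a
  homomorphism. \<open>W\<close> is the preimage of its image.\<close>

lemma mth_powers_mod_lcs:
  fixes i m :: nat
  assumes P: "subgroup P G"
  defines "W \<equiv> {z \<in> lcs G P i. \<exists>w\<in>lcs G P i. z \<otimes> inv (w [^] m) \<in> lcs G P (Suc i)}"
  shows "subgroup W G" "lcs G P (Suc i) \<subseteq> W"
proof -
  let ?L = "lcs G P i" and ?L' = "lcs G P (Suc i)"
  let ?Q = "G\<lparr>carrier := P\<rparr> Mod ?L'" and ?\<pi> = "\<lambda>x. ?L' #> x"
  note q = lcs_quotient [OF P, where n = "Suc i"]
  interpret Q: group ?Q
    by (rule q(1))
  have LP: "?L \<subseteq> P" and L: "subgroup ?L G" and L': "subgroup ?L' G" and L'L: "?L' \<subseteq> ?L"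
    using P by (simp_all only: lcs_subset lcs_subgroup lcs_Suc_subset)
  have PG: "P \<subseteq> carrier G"
    by (rule subgroup.subset [OF P])
  have W_iff: "z \<in> W \<longleftrightarrow> z \<in> ?L \<and> (\<exists>w\<in>?L. ?\<pi> z = ?\<pi> w [^]\<^bsub>?Q\<^esub> m)" for z
  proof -
    have "z \<otimes> inv (w [^] m) \<in> ?L' \<longleftrightarrow> ?\<pi> z = ?\<pi> w [^]\<^bsub>?Q\<^esub> m" if "z \<in> ?L" "w \<in> ?L" for w
      using that LP P by (subst q(3) [symmetric]) (auto simp only: q(7) nat_pow_in_subgroup subsetD)
    then show ?thesis
      unfolding W_def by blast
  qed
  show "?L' \<subseteq> W"
  proof
    fix z assume z: "z \<in> ?L'"
    then have "z \<in> ?L" "z \<in> carrier G"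
      using L'L LP PG by blast+
    moreover have "z \<otimes> inv (\<one> [^] m) \<in> ?L'" "\<one> \<in> ?L"
      using z \<open>z \<in> carrier G\<close> by (simp_all del: lcs.simps add: subgroup.one_closed L)
    ultimately show "z \<in> W"
      unfolding W_def by blast
  qed
  show "subgroup W G"
  proof (rule subgroupI)
    show "W \<subseteq> carrier G"
      using LP PG by (auto simp: W_def)
    show "W \<noteq> {}"
      using \<open>?L' \<subseteq> W\<close> subgroup.one_closed [OF L'] by blast
  next
    fix z assume "z \<in> W"
    then obtain w where z: "z \<in> ?L" "z \<in> P" and w: "w \<in> ?L" "w \<in> P" and eq: "?\<pi> z = ?\<pi> w [^]\<^bsub>?Q\<^esub> m"
      using LP unfolding W_iff by blast
    have "?\<pi> (inv z) = ?\<pi> (inv w) [^]\<^bsub>?Q\<^esub> m"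
      using z w eq by (simp only: q(4,6) Q.nat_pow_inv)
    then show "inv z \<in> W"
      unfolding W_iff using z w subgroup.m_inv_closed [OF L] by blast
  next
    fix z z' assume "z \<in> W" "z' \<in> W"
    then obtain w w' where z: "z \<in> ?L" "z \<in> P" and w: "w \<in> ?L" "w \<in> P"
      and z': "z' \<in> ?L" "z' \<in> P" and w': "w' \<in> ?L" "w' \<in> P"
      and eq: "?\<pi> z = ?\<pi> w [^]\<^bsub>?Q\<^esub> m" "?\<pi> z' = ?\<pi> w' [^]\<^bsub>?Q\<^esub> m"
      using LP unfolding W_iff by blast
    have "?\<pi> (z \<otimes> z') = ?\<pi> (w \<otimes> w') [^]\<^bsub>?Q\<^esub> m"
      using z z' w w'
      by (simp only: q(4,5) eq Q.pow_mult_distrib [OF lcs_quotient_commute [OF P w(1) w'(2)]])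
    then show "z \<otimes> z' \<in> W"
      unfolding W_iff using z z' w w' subgroup.m_closed [OF L] by blast
  qed
qed

text \<open>At index 0 the generators are m-th powers. Further down, [a, x^m] is congruent to
  [a, x]^m modulo the following term, so every generating commutator with an m-th power as second
  entry is an m-th power up to that term.\<close>

lemma lcs_pow_subgroup_mth_powers:
  assumes P: "subgroup P G" and z: "z \<in> lcs G (pow_subgroup m P) i"
  shows "z \<in> lcs G P i \<and> (\<exists>w\<in>lcs G P i. z \<otimes> inv (w [^] m) \<in> lcs G P (Suc i))"
proof -
  let ?W = "\<lambda>i. {z \<in> lcs G P i. \<exists>w\<in>lcs G P i. z \<otimes> inv (w [^] m) \<in> lcs G P (Suc i)}"
  let ?R = "pow_subgroup m P" and ?S = "(\<lambda>x. x [^] m) ` P"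
  note W = mth_powers_mod_lcs [OF P]
  have R: "subgroup ?R G" "?R \<subseteq> P"
    using pow_subgroup [OF P] by blast+
  have PG: "P \<subseteq> carrier G"
    by (rule subgroup.subset [OF P])
  have RP: "lcs G ?R j \<subseteq> lcs G P j" for j
    by (rule lcs_mono [OF R(2)])
  have S: "generate G ?S = ?R"
    by (simp add: pow_subgroup_def)
  have "lcs G ?R i \<subseteq> ?W i"
  proof (cases i)
    case 0
    have "x [^] m \<in> ?W 0" if "x \<in> P" for x
    proof -
      have "x [^] m \<in> carrier G"
        using that PG by auto
      then have "x [^] m \<otimes> inv (x [^] m) \<in> lcs G P (Suc 0)"
        using subgroup.one_closed [OF lcs_subgroup [OF P, of "Suc 0"]] by (simp del: lcs.simps)
      then show ?thesis
        using that nat_pow_in_subgroup [OF P that] unfolding lcs.simps(1) by blast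
    qed
    then have "?S \<subseteq> ?W 0"
      by blast
    then have "generate G ?S \<subseteq> ?W 0"
      by (rule generate_subgroup_incl) (rule W(1))
    then show ?thesis
      unfolding 0 S lcs.simps(1) .
  next
    case (Suc j)
    let ?L' = "lcs G P (Suc j)" and ?L'' = "lcs G P (Suc (Suc j))"
    let ?Q = "G\<lparr>carrier := P\<rparr> Mod ?L''" and ?\<pi> = "\<lambda>x. ?L'' #> x"
    note q = lcs_quotient [OF P, where n = "Suc (Suc j)"]
    interpret Q: group ?Q
      by (rule q(1))
    have "comm G a s \<in> ?W (Suc j)" if a: "a \<in> lcs G ?R j" and s: "s \<in> ?S" for a s
    proof -
      obtain x where x: "x \<in> P" and sx: "s = x [^] m"
        using s by blast
      have aL: "a \<in> lcs G P j" "a \<in> P" and sP: "s \<in> P"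
        using a RP lcs_subset [OF P] nat_pow_in_subgroup [OF P x] sx by blast+
      have c: "comm G a x \<in> ?L'" "comm G a x \<in> P" "comm G a s \<in> ?L'" "comm G a s \<in> P"
        using comm_in_lcs(1) [OF P aL(1)] x sP lcs_subset [OF P] by blast+
      have "?\<pi> (comm G a s) = comm ?Q (?\<pi> a) (?\<pi> x [^]\<^bsub>?Q\<^esub> m)"
        using aL x sP unfolding sx by (simp only: q(7,8))
      also have "\<dots> = comm ?Q (?\<pi> a) (?\<pi> x) [^]\<^bsub>?Q\<^esub> m"
        using aL x lcs_quotient_commute [OF P c(1) x] by (intro Q.comm_pow_right) (simp_all only: q(4,8))
      also have "\<dots> = ?\<pi> (comm G a x [^] m)"
        using aL x c by (simp only: q(7,8))
      finally have "comm G a s \<otimes> inv (comm G a x [^] m) \<in> ?L''"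
        using c nat_pow_in_subgroup [OF P c(2)] by (subst (asm) q(3))
      then show ?thesis
        using c by blast
    qed
    then show ?thesis
      unfolding Suc
      by (rule lcs_Suc_subset_generated [OF R(1) W(1) subset_trans [OF RP W(2)] S])
  qed
  then show ?thesis
    using z by blast
qed

text \<open>Each iteration pushes the error one term down. For \<open>R = pow_subgroup m P\<close>,
  write h = z y^m with z in the term of index i for \<open>R\<close>; then z is congruent to w^m
  with w central modulo the next term of \<open>P\<close>, so h is congruent to (w y)^m.\<close>

theorem funpow_pow_subgroup_mth_power:
  assumes P: "subgroup P G" and nil: "lcs G P n = {\<one>}" and h: "h \<in> (pow_subgroup m ^^ n) P"
  shows "\<exists>y\<in>P. h = y [^] m"
proof -
  \<comment> \<open>\<open>P\<close> is left arbitrary because the induction hypothesis is applied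
    to \<open>pow_subgroup m P\<close>. The number of iterations equals the index of the term
    containing the error.\<close>
  have "\<exists>y\<in>P. h \<otimes> inv (y [^] m) \<in> lcs G P i" if "subgroup P G" "h \<in> (pow_subgroup m ^^ i) P" for i P
    using that
  proof (induction i arbitrary: P)
    case 0
    then have "h \<otimes> inv (\<one> [^] m) \<in> lcs G P 0" "\<one> \<in> P"
      by (auto simp: subgroup.mem_carrier subgroup.one_closed)
    then show ?case
      by blast
  next
    case (Suc i)
    note P = Suc.prems(1)
    let ?R = "pow_subgroup m P"
    let ?L = "lcs G P i" and ?L' = "lcs G P (Suc i)"
    let ?Q = "G\<lparr>carrier := P\<rparr> Mod ?L'" and ?\<pi> = "\<lambda>x. ?L' #> x"
    note q = lcs_quotient [OF P, where n = "Suc i"]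
    interpret Q: group ?Q
      by (rule q(1))
    have R: "subgroup ?R G" "?R \<subseteq> P"
      using pow_subgroup [OF P] by blast+
    have PG: "P \<subseteq> carrier G"
      by (rule subgroup.subset [OF P])
    have LP: "?L \<subseteq> P"
      using P by (simp only: lcs_subset)
    have "h \<in> (pow_subgroup m ^^ i) ?R"
      using Suc.prems(2) by (simp add: funpow_swap1)
    then obtain y where y: "y \<in> ?R" and z: "h \<otimes> inv (y [^] m) \<in> lcs G ?R i"
      using Suc.IH [OF R(1)] by blast
    define z where "z = h \<otimes> inv (y [^] m)"
    obtain w where zL: "z \<in> ?L" and w: "w \<in> ?L" and zw: "z \<otimes> inv (w [^] m) \<in> ?L'"
      using lcs_pow_subgroup_mth_powers [OF P z] unfolding z_def by blast
    have yP: "y \<in> P" "y [^] m \<in> P" and wP: "w \<in> P" "w [^] m \<in> P" "w \<otimes> y \<in> P" "(w \<otimes> y) [^] m \<in> P" and zP: "z \<in> P"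
      using y w R LP zL P by (auto intro!: nat_pow_in_subgroup subgroup.m_closed)
    have hG: "h \<in> carrier G"
      by (rule subgroup.mem_carrier [OF funpow_pow_subgroup(1) [OF P] Suc.prems(2)])
    have hz: "h = z \<otimes> y [^] m"
      using hG yP PG unfolding z_def by (simp add: m_assoc subset_iff)
    have hP: "h \<in> P"
      unfolding hz using zP yP subgroup.m_closed [OF P] by blast
    have "?\<pi> z = ?\<pi> (w [^] m)"
      using zw zP wP by (subst q(3))
    then have "?\<pi> h = ?\<pi> (w [^] m) \<otimes>\<^bsub>?Q\<^esub> ?\<pi> (y [^] m)"
      unfolding hz using zP yP by (simp only: q(5))
    also have "\<dots> = ?\<pi> ((w \<otimes> y) [^] m)"
      using wP yP
      by (simp only: q(4,5,7) Q.pow_mult_distrib [OF lcs_quotient_commute [OF P w yP(1)]])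
    finally have "h \<otimes> inv ((w \<otimes> y) [^] m) \<in> ?L'"
      using hP wP by (subst (asm) q(3))
    then show ?case
      using wP by blast
  qed
  from this [OF P h] obtain y where y: "y \<in> P" and eq: "h \<otimes> inv (y [^] m) = \<one>"
    unfolding nil by blast
  have "h \<in> carrier G" "y \<in> carrier G"
    by (rule subgroup.mem_carrier [OF funpow_pow_subgroup(1) [OF P] h],
        rule subgroup.mem_carrier [OF P y])
  then have "h = y [^] m"
    using eq inv_solve_right' [of \<one> h "y [^] m"] by simp
  then show ?thesis
    using y by blast
qed

end

section \<open>Isolators in nilpotent groups\<close>

text \<open>Used to see that the square of a nilpotent group is nilpotent, so that results on
  isolators apply to the graph of a homomorphism.\<close>

lemma lcs_DirProd_subset:
  assumes G: "group G" and H: "group H"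
  shows "lcs (G \<times>\<times> H) (carrier (G \<times>\<times> H)) n \<subseteq> lcs G (carrier G) n \<times> lcs H (carrier H) n"
proof (induction n)
  case (Suc n)
  interpret G: group G by (rule G)
  interpret H: group H by (rule H)
  interpret GH: group "G \<times>\<times> H" by (rule DirProd_group [OF G H])
  let ?L = "\<lambda>n. lcs G (carrier G) n \<times> lcs H (carrier H) n"
  have LG: "lcs G (carrier G) n \<subseteq> carrier G" and LH: "lcs H (carrier H) n \<subseteq> carrier H"
    using G.lcs_subset [OF G.subgroup_self] H.lcs_subset [OF H.subgroup_self] by auto
  have "subgroup (?L (Suc n)) (G \<times>\<times> H)"
    by (intro DirProd_subgroups G H G.lcs_subgroup H.lcs_subgroup G.subgroup_self H.subgroup_self)
  moreover have "comm (G \<times>\<times> H) p q \<in> ?L (Suc n)"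
    if pq: "p \<in> lcs (G \<times>\<times> H) (carrier (G \<times>\<times> H)) n" "q \<in> carrier (G \<times>\<times> H)" for p q
  proof -
    obtain a b where p: "p = (a, b)" and a: "a \<in> lcs G (carrier G) n" and b: "b \<in> lcs H (carrier H) n"
      using Suc pq by blast
    obtain c d where q: "q = (c, d)" and c: "c \<in> carrier G" and d: "d \<in> carrier H"
      using pq by auto
    have ab: "a \<in> carrier G" "b \<in> carrier H"
      using a b LG LH by auto
    have "comm (G \<times>\<times> H) p q = (comm G a c, comm H b d)"
      unfolding comm_def p q by (simp only: mult_DirProd inv_DirProd [OF G H] ab c d)
    then show ?thesis
      using G.comm_in_lcs(1) [OF G.subgroup_self a c] H.comm_in_lcs(1) [OF H.subgroup_self b d]
      by (simp only: mem_Times_iff fst_conv snd_conv)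
  qed
  ultimately show ?case
    unfolding GH.lcs_Suc by (intro GH.generate_subgroup_incl) blast
qed simp

lemma (in group) lcs_eq_one:
  assumes nil: "lcs G (carrier G) n = {\<one>}" and P: "subgroup P G"
  shows "lcs G P n = {\<one>}"
proof
  show "lcs G P n \<subseteq> {\<one>}"
    using lcs_mono [OF subgroup.subset [OF P]] unfolding nil [symmetric] .
  show "{\<one>} \<subseteq> lcs G P n"
    using subgroup.one_closed [OF lcs_subgroup [OF P]] by simp
qed

text \<open>The elements with a power in \<open>H\<close> form the isolator of \<open>H\<close>.
  Closure under products is \<open>power_in_subgroup_of_generators\<close> for the subgroup
  generated by x and y.\<close>

lemma (in group) isolator_mult_closed:
  assumes nil: "lcs G (carrier G) n = {\<one>}" and H: "subgroup H G"
    and x: "x \<in> carrier G" "x [^] k \<in> H" "k \<ge> (1::nat)"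
    and y: "y \<in> carrier G" "y [^] l \<in> H" "l \<ge> (1::nat)"
  shows "\<exists>m\<ge>1::nat. (x \<otimes> y) [^] m \<in> H"
proof -
  let ?P = "generate G {x, y}"
  have P: "subgroup ?P G"
    using x y by (intro generate_is_subgroup) auto
  show ?thesis
  proof (rule power_in_subgroup_of_generators [OF P lcs_eq_one [OF nil P] refl H])
    show "\<exists>k\<ge>1::nat. s [^] k \<in> H" if "s \<in> {x, y}" for s
      using that x y by blast
    show "x \<otimes> y \<in> ?P"
      by (intro generate.eng generate.incl) auto
  qed
qed

lemma nat_pow_DirProd: "(x, y) [^]\<^bsub>G \<times>\<times> H\<^esub> (k::nat) = (x [^]\<^bsub>G\<^esub> k, y [^]\<^bsub>H\<^esub> k)"
  by (induction k) (simp_all only: nat_pow_def nat.rec one_DirProd mult_DirProd)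

lemma (in group) conj_nat_pow:
  assumes "x \<in> carrier G" "g \<in> carrier G"
  shows "(x \<otimes> g \<otimes> inv x) [^] (k::nat) = x \<otimes> g [^] k \<otimes> inv x"
proof (induction k)
  case (Suc k)
  then show ?case
    using assms by (simp add: m_assoc)
qed (use assms in simp)

text \<open>Take the last term of the series that \<open>N\<close> meets nontrivially. For z in this
  intersection, [z, g] lies both in \<open>N\<close> and in the next term, hence is trivial.\<close>

lemma (in group) normal_meets_centre:
  assumes A: "subgroup A G" and nil: "lcs G A n = {\<one>}"
    and N: "N \<lhd> G\<lparr>carrier := A\<rparr>" and "N \<noteq> {\<one>}"
  shows "\<exists>z\<in>N. z \<noteq> \<one> \<and> (\<forall>g\<in>A. z \<otimes> g = g \<otimes> z)"
proof -
  interpret A: group "G\<lparr>carrier := A\<rparr>"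
    using A by (rule subgroup_imp_group)
  have NA: "subgroup N G" and sub: "N \<subseteq> A"
    using incl_subgroup [OF A normal_imp_subgroup [OF N]] normal_imp_subgroup [OF N] subgroup.subset
    by fastforce+
  have AG: "A \<subseteq> carrier G"
    by (rule subgroup.subset [OF A])
  define i where "i = (LEAST i. N \<inter> lcs G A i \<subseteq> {\<one>})"
  have i: "N \<inter> lcs G A i \<subseteq> {\<one>}"
    unfolding i_def by (rule LeastI [of _ n]) (simp add: nil)
  have "\<not> N \<inter> lcs G A 0 \<subseteq> {\<one>}"
    using \<open>N \<noteq> {\<one>}\<close> sub subgroup.one_closed [OF NA] by auto
  then obtain j where j: "i = Suc j"
    using i by (cases i) auto
  have "\<not> N \<inter> lcs G A j \<subseteq> {\<one>}"
    using not_less_Least [of j "\<lambda>i. N \<inter> lcs G A i \<subseteq> {\<one>}"] j unfolding i_def by simp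
  then obtain z where z: "z \<in> N" "z \<in> lcs G A j" "z \<noteq> \<one>"
    by blast
  have "z \<otimes> g = g \<otimes> z" if g: "g \<in> A" for g
  proof -
    have zg: "z \<in> carrier G" "g \<in> carrier G" "z \<in> A"
      using z g sub AG by auto
    have "g \<otimes> inv z \<otimes> inv g \<in> N"
      using A.normal_invE(2) [OF N, of g "inv z"] g z A subgroup.m_inv_closed [OF NA] by simp
    then have "comm G z g \<in> N"
      using subgroup.m_closed [OF NA z(1)] zg by (simp add: comm_def m_assoc)
    moreover have "comm G z g \<in> lcs G A (Suc j)"
      using comm_in_lcs(1) [OF A z(2) g] .
    ultimately have "comm G z g = \<one>"
      using i unfolding j by blast
    then show ?thesis
      using zg by (simp add: comm_eq_one_iff)
  qed
  then show ?thesis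
    using z by blast
qed

section \<open>Transfer between subgroups\<close>

text \<open>The core of the proof, in one direction: both groups are subgroups of a common nilpotent
  group with unique roots, and each contains a power of every element.\<close>

lemma (in group) strongly_recurrent_transfer:
  assumes nil: "lcs G (carrier G) n = {\<one>}"
    and roots: "\<And>x y (k::nat). \<lbrakk>x \<in> carrier G; y \<in> carrier G; k \<ge> 1; x [^] k = y [^] k\<rbrakk> \<Longrightarrow> x = y"
    and A1: "subgroup A1 G" "generate G S1 = A1" "finite S1"
    and A2: "subgroup A2 G" "generate G S2 = A2" "finite S2"
    and powA1: "\<And>x. x \<in> carrier G \<Longrightarrow> \<exists>k\<ge>1::nat. x [^] k \<in> A1"
    and powA2: "\<And>x. x \<in> carrier G \<Longrightarrow> \<exists>k\<ge>1::nat. x [^] k \<in> A2"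
    and srss: "strongly_recurrent_self_similar (G\<lparr>carrier := A1\<rparr>)"
  shows "strongly_recurrent_self_similar (G\<lparr>carrier := A2\<rparr>)"
  unfolding strongly_recurrent_self_similar_def
proof (intro allI impI)
  note nil' = lcs_eq_one [OF nil]
  have pow_trans: "\<exists>k\<ge>1::nat. x [^] k \<in> C"
    if B: "\<exists>k\<ge>1::nat. x [^] k \<in> B" and C: "\<And>y. y \<in> B \<Longrightarrow> \<exists>k\<ge>1::nat. y [^] k \<in> C"
      and x: "x \<in> carrier G" for x B C
  proof -
    obtain k where k: "k \<ge> (1::nat)" "x [^] k \<in> B"
      using B by blast
    obtain l where l: "l \<ge> (1::nat)" "(x [^] k) [^] l \<in> C"
      using C [OF k(2)] by blast
    then have "x [^] (k * l) \<in> C" "k * l \<ge> 1"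
      using k(1) x by (auto simp: nat_pow_pow)
    then show ?thesis
      by blast
  qed
  have pow_fi: "\<exists>k\<ge>1::nat. x [^] k \<in> C"
    if "subgroup B G" "finite_index_subgroup C (G\<lparr>carrier := B\<rparr>)" "x \<in> B" for x B C
    using finite_index_subgroup_uniform_power [OF that(1,2)] that(3) by blast

  \<comment> \<open>Choice of \<open>K\<close> among the m-th powers of elements of
    \<open>H2\<close>\<close>
  fix H2 assume H2: "finite_index_subgroup H2 (G\<lparr>carrier := A2\<rparr>)"
  have A1G: "A1 \<subseteq> carrier G" and A2G: "A2 \<subseteq> carrier G"
    using A1 A2 by (simp_all add: subgroup.subset)
  have fiD: "subgroup C G" "C \<subseteq> B" if "finite_index_subgroup C (G\<lparr>carrier := B\<rparr>)" "subgroup B G" for C B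
  proof -
    show C: "subgroup C G"
      using that incl_subgroup by (auto simp: finite_index_subgroup_def)
    show "C \<subseteq> B"
      using that C by (simp add: finite_index_subgroup_restrict)
  qed
  note H2G = fiD [OF H2 A2(1)]
  have powH2: "\<exists>k\<ge>1::nat. x [^] k \<in> H2" if "x \<in> carrier G" for x
    using powA2 [OF that] pow_fi [OF A2(1) H2] that by (rule pow_trans)
  have "finite_index_subgroup (A2 \<inter> A1) (G\<lparr>carrier := A2\<rparr>)"
  proof (rule finite_index_subgroupI [OF A2(1) nil' [OF A2(1)] A2(2,3)])
    show "subgroup (A2 \<inter> A1) G"
      by (rule subgroups_Inter_pair [OF A2(1) A1(1)])
    show "\<exists>k\<ge>1::nat. x [^] k \<in> A2 \<inter> A1" if "x \<in> A2" for x
      using powA1 [of x] nat_pow_in_subgroup [OF A2(1) that] that A2G by blast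
  qed simp
  then obtain m where m: "m \<ge> (1::nat)" "\<And>x. x \<in> A2 \<Longrightarrow> x [^] m \<in> A1"
    using finite_index_subgroup_uniform_power [OF A2(1)] by blast
  \<comment> \<open>With n iterations every element of \<open>U\<close> is the m-th power of an
    element of \<open>H2\<close>, not merely a product of such powers. These roots become the
    preimages in the proof of surjectivity.\<close>
  define U where "U = (pow_subgroup m ^^ n) H2"
  have U: "subgroup U G"
    unfolding U_def by (rule funpow_pow_subgroup(1) [OF H2G(1)])
  have powU: "\<exists>k\<ge>1::nat. x [^] k \<in> U" if "x \<in> H2" for x
    using funpow_pow_subgroup(2) [OF H2G(1) that, of m n] m(1) unfolding U_def
    by (intro exI [of _ "m ^ n"]) simp
  have rootU: "\<exists>y\<in>H2. u = y [^] m" if "u \<in> U" for u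
    using funpow_pow_subgroup_mth_power [OF H2G(1) nil' [OF H2G(1)]] that unfolding U_def by blast
  have "finite_index_subgroup (U \<inter> A1) (G\<lparr>carrier := A1\<rparr>)"
  proof (rule finite_index_subgroupI [OF A1(1) nil' [OF A1(1)] A1(2,3)])
    show "subgroup (U \<inter> A1) G"
      by (rule subgroups_Inter_pair [OF U A1(1)])
    show "\<exists>k\<ge>1::nat. x [^] k \<in> U \<inter> A1" if "x \<in> A1" for x
    proof -
      have "x \<in> carrier G"
        using that A1G by blast
      then have "\<exists>k\<ge>1::nat. x [^] k \<in> U"
        using pow_trans [OF powH2 powU] by blast
      then show ?thesis
        using nat_pow_in_subgroup [OF A1(1) that] by blast
    qed
  qed simp
  then obtain K f where KH1: "finite_index_subgroup K (G\<lparr>carrier := A1\<rparr>\<lparr>carrier := U \<inter> A1\<rparr>)"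
    and simple: "simple_virtual_endomorphism (G\<lparr>carrier := A1\<rparr>) K f"
    and rec: "recurrent_virtual_endomorphism (G\<lparr>carrier := A1\<rparr>) K f"
    using srss unfolding strongly_recurrent_self_similar_def by blast
  have "finite_index_subgroup K (G\<lparr>carrier := U \<inter> A1\<rparr>)"
    using KH1 by simp
  then have KU: "K \<subseteq> U \<inter> A1"
    using fiD(2) subgroups_Inter_pair [OF U A1(1)] by blast
  have K1: "finite_index_subgroup K (G\<lparr>carrier := A1\<rparr>)" and fonto: "f ` K = A1"
    and fhom: "f \<in> hom (G\<lparr>carrier := K\<rparr>) (G\<lparr>carrier := A1\<rparr>)"
    using rec unfolding recurrent_virtual_endomorphism_def virtual_endomorphism_def by simp_all
  have K: "subgroup K G"
    by (rule fiD(1) [OF K1 A1(1)])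
  have KG: "K \<subseteq> carrier G"
    by (rule subgroup.subset [OF K])
  have powK: "\<exists>k\<ge>1::nat. x [^] k \<in> K" if "x \<in> carrier G" for x
    using powA1 [OF that] pow_fi [OF A1(1) K1] that by (rule pow_trans)
  interpret f: group_hom "G\<lparr>carrier := K\<rparr>" "G\<lparr>carrier := A1\<rparr>" f
    using fhom K A1(1) by (auto simp: group_hom_def group_hom_axioms_def subgroup_imp_group)
  have fA1: "f x \<in> A1" "f x \<in> carrier G" if "x \<in> K" for x
    using that fonto A1G by blast+
  have fmult: "f (x \<otimes> y) = f x \<otimes> f y" if "x \<in> K" "y \<in> K" for x y
    using f.hom_mult that by simp
  have fpow: "f (x [^] k) = f x [^] k" if "x \<in> K" for x and k :: nat
    using f.hom_nat_pow [of x k] that by (simp add: nat_pow_consistent [symmetric])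
  have finv: "f (inv x) = inv (f x)" if "x \<in> K" for x
    using f.hom_inv [of x] that fA1(1) [OF that] K A1(1) by simp
  have fone: "f \<one> = \<one>"
    using f.hom_one by simp

  \<comment> \<open>The root closure of the graph of \<open>f\<close>\<close>
  define R where "R y x \<longleftrightarrow> y \<in> carrier G \<and> x \<in> carrier G \<and> (\<exists>k\<ge>1::nat. y [^] k \<in> K \<and> f (y [^] k) = x [^] k)" for y x
  let ?\<Gamma> = "{(y, f y) | y. y \<in> K}"
  \<comment> \<open>\<open>R\<close> is the isolator of the graph \<open>?\<Gamma>\<close> in the
    direct square: the same exponent is used in both coordinates. Closure under products then comes
    from nilpotency of the square.\<close>
  have R_iff: "R y x \<longleftrightarrow> y \<in> carrier G \<and> x \<in> carrier G \<and> (\<exists>k\<ge>1::nat. (y, x) [^]\<^bsub>G \<times>\<times> G\<^esub> k \<in> ?\<Gamma>)" for y x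
    unfolding R_def by (auto simp: nat_pow_DirProd)
  interpret GG: group "G \<times>\<times> G"
    by (rule DirProd_group [OF is_group is_group])
  have nilGG: "lcs (G \<times>\<times> G) (carrier (G \<times>\<times> G)) n = {\<one>\<^bsub>G \<times>\<times> G\<^esub>}"
    using lcs_DirProd_subset [OF is_group is_group, of n]
      subgroup.one_closed [OF GG.lcs_subgroup [OF GG.subgroup_self, of n]]
    unfolding nil by auto
  have \<Gamma>: "subgroup ?\<Gamma> (G \<times>\<times> G)"
  proof (rule GG.subgroupI)
    show "?\<Gamma> \<subseteq> carrier (G \<times>\<times> G)"
      using KG fA1 by auto
    show "?\<Gamma> \<noteq> {}"
      using subgroup.one_closed [OF K] by blast
  next
    fix p assume "p \<in> ?\<Gamma>"
    then obtain y where y: "y \<in> K" "p = (y, f y)"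
      by blast
    then have "inv\<^bsub>G \<times>\<times> G\<^esub> p = (inv y, f (inv y))"
      using KG fA1 by (simp add: finv subset_iff)
    then show "inv\<^bsub>G \<times>\<times> G\<^esub> p \<in> ?\<Gamma>"
      using subgroup.m_inv_closed [OF K y(1)] by blast
  next
    fix p q assume "p \<in> ?\<Gamma>" "q \<in> ?\<Gamma>"
    then obtain y z where y: "y \<in> K" "p = (y, f y)" and z: "z \<in> K" "q = (z, f z)"
      by blast
    then have "p \<otimes>\<^bsub>G \<times>\<times> G\<^esub> q = (y \<otimes> z, f (y \<otimes> z))"
      by (simp add: fmult)
    then show "p \<otimes>\<^bsub>G \<times>\<times> G\<^esub> q \<in> ?\<Gamma>"
      using subgroup.m_closed [OF K y(1) z(1)] by blast
  qed
  have R_mult: "R (y \<otimes> y') (x \<otimes> x')" if R: "R y x" "R y' x'" for y x y' x'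
  proof -
    obtain k l where "k \<ge> (1::nat)" "(y, x) [^]\<^bsub>G \<times>\<times> G\<^esub> k \<in> ?\<Gamma>" "l \<ge> (1::nat)" "(y', x') [^]\<^bsub>G \<times>\<times> G\<^esub> l \<in> ?\<Gamma>"
      and G: "(y, x) \<in> carrier (G \<times>\<times> G)" "(y', x') \<in> carrier (G \<times>\<times> G)"
      using R unfolding R_iff by auto
    then have "\<exists>k\<ge>1::nat. ((y, x) \<otimes>\<^bsub>G \<times>\<times> G\<^esub> (y', x')) [^]\<^bsub>G \<times>\<times> G\<^esub> k \<in> ?\<Gamma>"
      by (intro GG.isolator_mult_closed [OF nilGG \<Gamma>])
    then show ?thesis
      unfolding R_iff mult_DirProd using G by simp
  qed
  have R_inv: "R (inv y) (inv x)" if R: "R y x" for y x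
  proof -
    obtain k where k: "k \<ge> (1::nat)" "y [^] k \<in> K" "f (y [^] k) = x [^] k" and G: "y \<in> carrier G" "x \<in> carrier G"
      using R unfolding R_def by blast
    have "inv y [^] k \<in> K" "f (inv y [^] k) = inv x [^] k"
      using k G subgroup.m_inv_closed [OF K k(2)] by (simp_all add: nat_pow_inv finv)
    then show ?thesis
      unfolding R_def using k(1) G by blast
  qed
  \<comment> \<open>For the common exponent k l, both values are roots of f (y^(k l)), and roots are
    unique.\<close>
  have R_unique: "x = x'" if R: "R y x" "R y x'" for y x x'
  proof -
    obtain k where k: "k \<ge> (1::nat)" "y [^] k \<in> K" "f (y [^] k) = x [^] k" and G: "y \<in> carrier G" "x \<in> carrier G"
      using R(1) unfolding R_def by blast
    obtain l where l: "l \<ge> (1::nat)" "y [^] l \<in> K" "f (y [^] l) = x' [^] l" and G': "x' \<in> carrier G"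
      using R(2) unfolding R_def by blast
    have "x [^] (k * l) = (x [^] k) [^] l"
      using G by (simp only: nat_pow_pow)
    also have "\<dots> = f ((y [^] k) [^] l)"
      unfolding fpow [OF k(2)] k(3) ..
    also have "\<dots> = f ((y [^] l) [^] k)"
      using G by (simp add: nat_pow_pow mult.commute)
    also have "\<dots> = (x' [^] l) [^] k"
      unfolding fpow [OF l(2)] l(3) ..
    also have "\<dots> = x' [^] (k * l)"
      using G' by (simp only: nat_pow_pow mult.commute)
    finally show ?thesis
      using roots [of x x' "k * l"] k(1) l(1) G G' by simp
  qed
  have R_f: "R y (f y)" if "y \<in> K" for y
    unfolding R_def using that KG fA1 [OF that] by (intro conjI exI [of _ "1::nat"]) auto

  \<comment> \<open>The induced virtual endomorphism of \<open>A2\<close>\<close>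
  define K2 where "K2 = {y \<in> H2. \<exists>x\<in>A2. R y x}"
  \<comment> \<open>Uniqueness of \<open>R\<close> makes this choice well defined wherever
    \<open>R\<close> relates \<open>y\<close> to something; values at other arguments are arbitrary
    and lie outside \<open>K2\<close>.\<close>
  define f2 where "f2 y = (THE x. R y x)" for y
  have f2: "f2 y = x" if "R y x" for y x
    unfolding f2_def using that R_unique by blast
  have K2: "f2 y \<in> A2" "R y (f2 y)" "y \<in> H2" if "y \<in> K2" for y
    using that f2 unfolding K2_def by auto
  have K2I: "y \<in> K2" if "y \<in> H2" "x \<in> A2" "R y x" for y x
    using that unfolding K2_def by blast
  have K2H2: "K2 \<subseteq> H2" and K2A2: "K2 \<subseteq> A2"
    using H2G(2) unfolding K2_def by auto
  have K2sub: "subgroup K2 G"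
  proof (rule subgroupI)
    show "K2 \<subseteq> carrier G"
      using K2A2 A2G by blast
    show "K2 \<noteq> {}"
      using K2I [OF subgroup.one_closed [OF H2G(1)] subgroup.one_closed [OF A2(1)]]
        R_f [OF subgroup.one_closed [OF K]] fone by auto
    show "inv y \<in> K2" if "y \<in> K2" for y
      using that K2 [OF that] R_inv
      by (blast intro: K2I subgroup.m_inv_closed [OF H2G(1)] subgroup.m_inv_closed [OF A2(1)])
    show "y \<otimes> z \<in> K2" if "y \<in> K2" "z \<in> K2" for y z
      using K2 [OF that(1)] K2 [OF that(2)] R_mult
      by (blast intro: K2I subgroup.m_closed [OF H2G(1)] subgroup.m_closed [OF A2(1)])
  qed
  have f2onto: "f2 ` K2 = A2"
  proof
    show "f2 ` K2 \<subseteq> A2"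
      using K2 by blast
    show "A2 \<subseteq> f2 ` K2"
    proof
      fix x assume x: "x \<in> A2"
      \<comment> \<open>A preimage of x is an m-th root of a preimage of x^m. Such a root exists in
        \<open>H2\<close> because \<open>K\<close> lies in \<open>U\<close>.\<close>
      have "x [^] m \<in> f ` K"
        using m(2) [OF x] fonto by simp
      then obtain k where k: "k \<in> K" "f k = x [^] m"
        by auto
      then obtain y where y: "y \<in> H2" "k = y [^] m"
        using rootU KU by blast
      have "R y x"
        unfolding R_def using x y k m(1) H2G(2) A2G by blast
      then show "x \<in> f2 ` K2"
        using K2I [OF y(1) x] f2 by blast
    qed
  qed
  have f2mult: "f2 (y \<otimes> z) = f2 y \<otimes> f2 z" if "y \<in> K2" "z \<in> K2" for y z
    using K2 [OF that(1)] K2 [OF that(2)] by (intro f2 R_mult)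
  have K2fi: "finite_index_subgroup K2 (G\<lparr>carrier := A2\<rparr>)"
  proof (rule finite_index_subgroupI [OF A2(1) nil' [OF A2(1)] A2(2,3) K2sub K2A2])
    fix x assume "x \<in> A2"
    then have xG: "x \<in> carrier G"
      using A2G by blast
    have "\<exists>k\<ge>1::nat. y [^] k \<in> K \<inter> H2" if "y \<in> H2" for y
      using powK [of y] nat_pow_in_subgroup [OF H2G(1) that] that H2G(2) A2G by blast
    \<comment> \<open>The value \<open>f y\<close> lies in \<open>A1\<close> and may miss
      \<open>A2\<close>. Raising to a power brings it into \<open>A2\<close>, and the same power of
      y then lies in \<open>K2\<close>.\<close>
    moreover have "\<exists>l\<ge>1::nat. y [^] l \<in> K2" if y: "y \<in> K \<inter> H2" for y
    proof -
      obtain l where l: "l \<ge> (1::nat)" "f y [^] l \<in> A2"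
        using powA2 fA1(2) y by blast
      have "R (y [^] l) (f y [^] l)"
        using R_f [of "y [^] l"] nat_pow_in_subgroup [OF K] fpow y by simp
      then show ?thesis
        using K2I [OF _ l(2)] nat_pow_in_subgroup [OF H2G(1)] y l(1) by blast
    qed
    ultimately show "\<exists>k\<ge>1::nat. x [^] k \<in> K2"
      using pow_trans [OF pow_trans [OF powH2 [OF xG]]] xG by blast
  qed
  have virt: "virtual_endomorphism (G\<lparr>carrier := A2\<rparr>) K2 f2"
    unfolding virtual_endomorphism_def using K2fi K2(1) f2mult by (auto simp: hom_def)
  have "finite_index_subgroup K2 (G\<lparr>carrier := H2\<rparr>)"
    using K2fi H2G K2H2 finite_subset [OF image_mono [OF H2G(2)]]
    by (auto simp: finite_index_subgroup_restrict [OF K2sub H2G(1)] finite_index_subgroup_restrict [OF K2sub A2(1)])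

  \<comment> \<open>Simplicity of the induced virtual endomorphism\<close>
  moreover have "N = {\<one>}" if NK2: "N \<subseteq> K2" and N: "N \<lhd> G\<lparr>carrier := A2\<rparr>" and fN: "f2 ` N \<subseteq> N" for N
  proof (rule ccontr)
    assume "N \<noteq> {\<one>}"
    then obtain z where z: "z \<in> N" "z \<noteq> \<one>" "\<forall>g\<in>A2. z \<otimes> g = g \<otimes> z"
      using normal_meets_centre [OF A2(1) nil' [OF A2(1)] N] by blast
    have Nsub: "subgroup N G"
      using incl_subgroup [OF A2(1) normal_imp_subgroup [OF N]] .
    define B where "B = {x \<in> N. \<forall>g\<in>A2. x \<otimes> g = g \<otimes> x}"
    have BN: "x \<in> N" "x \<in> K2" "x \<in> A2" "x \<in> carrier G" if "x \<in> B" for x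
      using that NK2 K2A2 A2G unfolding B_def by auto
    have B: "subgroup B G"
    proof (rule subgroupI)
      show "B \<subseteq> carrier G"
        using BN(4) by blast
      show "B \<noteq> {}"
        using z unfolding B_def by blast
    next
      fix x assume x: "x \<in> B"
      have "inv x \<otimes> g = g \<otimes> inv x" if g: "g \<in> A2" for g
      proof -
        have "x \<otimes> g = g \<otimes> x" "g \<in> carrier G"
          using x g A2G unfolding B_def by auto
        then show ?thesis
          using BN(4) [OF x] by (metis inv_closed inv_solve_left inv_solve_right m_assoc m_closed)
      qed
      then show "inv x \<in> B"
        using BN(1) [OF x] subgroup.m_inv_closed [OF Nsub] unfolding B_def by blast
    next
      fix x y assume xy: "x \<in> B" "y \<in> B"
      have "x \<otimes> y \<otimes> g = g \<otimes> (x \<otimes> y)" if g: "g \<in> A2" for g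
      proof -
        have "x \<otimes> g = g \<otimes> x" "y \<otimes> g = g \<otimes> y" "g \<in> carrier G"
          using xy g A2G unfolding B_def by auto
        then show ?thesis
          using BN(4) [OF xy(1)] BN(4) [OF xy(2)] by (metis m_assoc)
      qed
      then show "x \<otimes> y \<in> B"
        using BN(1) [OF xy(1)] BN(1) [OF xy(2)] subgroup.m_closed [OF Nsub] unfolding B_def by blast
    qed
    \<comment> \<open>Since \<open>f2\<close> maps \<open>K2\<close> onto \<open>A2\<close>, an
      element that commutes with \<open>K2\<close> has an image that commutes with all of
      \<open>A2\<close>.\<close>
    have f2B: "f2 x \<in> B" if x: "x \<in> B" for x
    proof -
      have "f2 x \<otimes> g = g \<otimes> f2 x" if g: "g \<in> A2" for g
      proof -
        obtain k where k: "k \<in> K2" "g = f2 k"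
          using g f2onto by blast
        then have "x \<otimes> k = k \<otimes> x"
          using x K2A2 unfolding B_def by blast
        then show ?thesis
          using f2mult [OF BN(2) [OF x] k(1)] f2mult [OF k(1) BN(2) [OF x]] k(2) by simp
      qed
      then show ?thesis
        using fN BN(1) [OF x] unfolding B_def by blast
    qed
    \<comment> \<open>Some power g^l lies in \<open>A2\<close> and commutes with x, so g and its
      conjugate by x have the same l-th power and coincide.\<close>
    have central: "x \<otimes> g = g \<otimes> x" if x: "x \<in> B" and g: "g \<in> carrier G" for x g
    proof -
      obtain l where l: "l \<ge> (1::nat)" "g [^] l \<in> A2"
        using powA2 [OF g] by blast
      have "(x \<otimes> g \<otimes> inv x) [^] l = x \<otimes> g [^] l \<otimes> inv x"
        using conj_nat_pow BN(4) [OF x] g by blast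
      also have "\<dots> = g [^] l \<otimes> x \<otimes> inv x"
        using x l(2) unfolding B_def by simp
      also have "\<dots> = g [^] l"
        using BN(4) [OF x] g by (simp add: m_assoc)
      finally have "x \<otimes> g \<otimes> inv x = g"
        using roots [of _ g l] l(1) BN(4) [OF x] g by simp
      then show ?thesis
        using BN(4) [OF x] g by (metis inv_solve_right' m_closed)
    qed
    have "finite_index_subgroup (A2 \<inter> K) (G\<lparr>carrier := A2\<rparr>)"
    proof (rule finite_index_subgroupI [OF A2(1) nil' [OF A2(1)] A2(2,3)])
      show "subgroup (A2 \<inter> K) G"
        by (rule subgroups_Inter_pair [OF A2(1) K])
      show "\<exists>k\<ge>1::nat. x [^] k \<in> A2 \<inter> K" if "x \<in> A2" for x
        using powK [of x] nat_pow_in_subgroup [OF A2(1) that] that A2G by blast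
    qed simp
    then obtain l where l: "l \<ge> (1::nat)" "\<And>x. x \<in> A2 \<Longrightarrow> x [^] l \<in> K"
      using finite_index_subgroup_uniform_power [OF A2(1)] by blast
    \<comment> \<open>The exponent l moves \<open>B\<close> into the domain of \<open>f\<close>. As
      \<open>B\<close> is central, the l-th powers form a subgroup that is normal in
      \<open>A1\<close>.\<close>
    let ?N = "(\<lambda>x. x [^] l) ` B"
    have NK: "?N \<subseteq> K"
      using l(2) BN(3) by blast
    have "?N \<lhd> G\<lparr>carrier := A1\<rparr>"
    proof -
      have "subgroup ?N G"
      proof (rule subgroupI)
        show "?N \<subseteq> carrier G"
          using NK KG by blast
        show "?N \<noteq> {}"
          using subgroup.one_closed [OF B] by blast
      next
        fix u assume "u \<in> ?N"
        then obtain x where x: "x \<in> B" "u = x [^] l"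
          by blast
        then have "inv u = inv x [^] l"
          using BN(4) by (simp add: nat_pow_inv)
        then show "inv u \<in> ?N"
          using subgroup.m_inv_closed [OF B x(1)] by blast
      next
        fix u v assume "u \<in> ?N" "v \<in> ?N"
        then obtain x y where x: "x \<in> B" "u = x [^] l" and y: "y \<in> B" "v = y [^] l"
          by blast
        then have "u \<otimes> v = (x \<otimes> y) [^] l"
          using pow_mult_distrib [OF central [OF x(1)]] BN(4) by simp
        then show "u \<otimes> v \<in> ?N"
          using subgroup.m_closed [OF B x(1) y(1)] by blast
      qed
      then have "subgroup ?N (G\<lparr>carrier := A1\<rparr>)"
        using NK KU A1(1) by (intro subgroup_incl) auto
      moreover have "g \<otimes> u \<otimes> inv g \<in> ?N" if g: "g \<in> A1" and u: "u \<in> ?N" for g u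
      proof -
        obtain x where x: "x \<in> B" "u = x [^] l"
          using u by blast
        have gG: "g \<in> carrier G"
          using g A1G by blast
        have "u \<otimes> g = g \<otimes> u"
          using central [OF nat_pow_in_subgroup [OF B x(1)] gG] x(2) by simp
        then have "g \<otimes> u \<otimes> inv g = u"
          using gG x BN(4) [OF x(1)] by (metis inv_solve_right' m_closed nat_pow_closed)
        then show ?thesis
          using u by simp
      qed
      ultimately show ?thesis
        using A1(1) by (auto simp: group.normal_inv_iff [OF subgroup_imp_group [OF A1(1)]])
    qed
    moreover have "f ` ?N \<subseteq> ?N"
    proof clarify
      fix x assume x: "x \<in> B"
      obtain k where k: "k \<ge> (1::nat)" "x [^] k \<in> K" "f (x [^] k) = f2 x [^] k"
        using K2(2) [OF BN(2) [OF x]] unfolding R_def by blast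
      have xl: "x [^] l \<in> K"
        using l(2) BN(3) [OF x] .
      have y: "f2 x \<in> carrier G"
        using BN(4) [OF f2B [OF x]] .
      \<comment> \<open>The exponent k from \<open>R\<close> gives f (x^l) and (f2 x)^l the same
        k-th power; uniqueness of roots makes them equal.\<close>
      have "f (x [^] l) [^] k = f ((x [^] l) [^] k)"
        by (rule fpow [OF xl, symmetric])
      also have "\<dots> = f ((x [^] k) [^] l)"
        using BN(4) [OF x] by (simp add: nat_pow_pow mult.commute)
      also have "\<dots> = (f2 x [^] k) [^] l"
        unfolding fpow [OF k(2)] k(3) ..
      also have "\<dots> = (f2 x [^] l) [^] k"
        using y by (simp only: nat_pow_pow mult.commute)
      finally have "f (x [^] l) = f2 x [^] l"
        using roots [OF fA1(2) [OF xl] _ k(1)] y by simp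
      then show "f (x [^] l) \<in> ?N"
        using f2B [OF x] by simp
    qed
    ultimately have "?N = {\<one>}"
      using simple NK unfolding simple_virtual_endomorphism_def by auto
    moreover have "z \<in> B"
      using z unfolding B_def by blast
    ultimately have "z [^] l = \<one> [^] l"
      by auto
    then show False
      using roots [of z \<one> l] l(1) BN(4) [OF \<open>z \<in> B\<close>] z(2) by simp
  qed
  ultimately show "\<exists>K f. finite_index_subgroup K (G\<lparr>carrier := A2, carrier := H2\<rparr>) \<and>
      simple_virtual_endomorphism (G\<lparr>carrier := A2\<rparr>) K f \<and>
      recurrent_virtual_endomorphism (G\<lparr>carrier := A2\<rparr>) K f"
    using virt f2onto
    unfolding simple_virtual_endomorphism_def recurrent_virtual_endomorphism_def
    by (intro exI [of _ K2] exI [of _ f2]) auto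
qed

section \<open>Invariance under isomorphism\<close>

lemma finite_index_subgroup_image:
  assumes G: "group G" and G': "group G'" and h: "h \<in> iso G G'" and H: "finite_index_subgroup H G"
  shows "finite_index_subgroup (h ` H) G'"
proof -
  interpret h: group_hom G G' h
    using assms iso_imp_homomorphism by (auto simp: group_hom_def group_hom_axioms_def)
  have sub: "subgroup H G"
    using H by (simp add: finite_index_subgroup_def)
  have "h ` H #>\<^bsub>G'\<^esub> h a = h ` (H #>\<^bsub>G\<^esub> a)" if "a \<in> carrier G" for a
    using that subgroup.mem_carrier [OF sub] by (force simp: r_coset_def)
  moreover have "carrier G' = h ` carrier G"
    using h by (simp add: iso_iff)
  ultimately have "rcosets\<^bsub>G'\<^esub> (h ` H) = (\<lambda>C. h ` C) ` (rcosets\<^bsub>G\<^esub> H)"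
    by (auto simp: RCOSETS_def)
  then show ?thesis
    using H h.subgroup_img_is_subgroup [OF sub] by (simp add: finite_index_subgroup_def)
qed

text \<open>The virtual endomorphism is conjugated by the isomorphism h with inverse g. A normal
  invariant subgroup on the target side pulls back under g to one for \<open>f\<close>, hence is
  trivial.\<close>

lemma strongly_recurrent_self_similar_iso:
  assumes G: "group G" and G': "group G'" and "G \<cong> G'" and srss: "strongly_recurrent_self_similar G"
  shows "strongly_recurrent_self_similar G'"
  unfolding strongly_recurrent_self_similar_def
proof (intro allI impI)
  interpret G: group G by (rule G)
  interpret G': group G' by (rule G')
  obtain h where h: "h \<in> iso G G'"
    using \<open>G \<cong> G'\<close> by (auto simp: is_iso_def)
  define g where "g = inv_into (carrier G) h"
  have g: "g \<in> iso G' G"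
    unfolding g_def by (rule G.iso_set_sym [OF h])
  have hom: "h \<in> hom G G'" "g \<in> hom G' G"
    using h g iso_imp_homomorphism by blast+
  have onto: "h ` carrier G = carrier G'" and inj: "inj_on h (carrier G)"
    using h by (simp_all add: iso_iff)
  have gh: "g (h x) = x" if "x \<in> carrier G" for x
    using that inj by (simp add: g_def)
  have hg: "h (g y) = y" if "y \<in> carrier G'" for y
    unfolding g_def using that onto by (simp add: f_inv_into_f)
  have hcl: "h x \<in> carrier G'" if "x \<in> carrier G" for x
    using that onto by blast
  have gcl: "g y \<in> carrier G" if "y \<in> carrier G'" for y
    using g that by (auto simp: iso_iff)
  interpret h: group_hom G G' h
    using G G' hom by (simp add: group_hom_def group_hom_axioms_def)
  fix H' assume H': "finite_index_subgroup H' G'"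
  define H where "H = g ` H'"
  have fiH: "finite_index_subgroup H G"
    unfolding H_def by (rule finite_index_subgroup_image [OF G' G g H'])
  then obtain K f where K: "finite_index_subgroup K (G\<lparr>carrier := H\<rparr>)"
    and simple: "simple_virtual_endomorphism G K f" and rec: "recurrent_virtual_endomorphism G K f"
    using srss unfolding strongly_recurrent_self_similar_def by blast
  have H: "subgroup H G" "subgroup H' G'" "H' \<subseteq> carrier G'" "H \<subseteq> carrier G"
    using fiH H' by (simp_all add: finite_index_subgroup_def subgroup.subset)
  have hH: "h ` H = H'"
    using H(3) hg by (force simp: H_def image_image)
  have "h \<in> iso (G\<lparr>carrier := H\<rparr>) (G'\<lparr>carrier := H'\<rparr>)"
    using H hH inj_on_subset [OF inj H(4)] by (auto simp: iso_iff hom_def subset_iff)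
  then have K': "finite_index_subgroup (h ` K) (G'\<lparr>carrier := H'\<rparr>)"
    by (rule finite_index_subgroup_image [OF G.subgroup_imp_group [OF H(1)] G'.subgroup_imp_group [OF H(2)] _ K])
  have Kfi: "finite_index_subgroup K G" and fhom: "f \<in> hom (G\<lparr>carrier := K\<rparr>) G" and fonto: "f ` K = carrier G"
    using rec by (simp_all add: recurrent_virtual_endomorphism_def virtual_endomorphism_def)
  have Ksub: "subgroup K G"
    using Kfi by (simp add: finite_index_subgroup_def)
  have KG: "K \<subseteq> carrier G"
    by (rule subgroup.subset [OF Ksub])
  let ?f = "h \<circ> f \<circ> g"
  have fK: "?f (h x) = h (f x)" "f x \<in> carrier G" if "x \<in> K" for x
    using that KG gh fonto by (auto simp: subset_iff)
  have "?f (h x \<otimes>\<^bsub>G'\<^esub> h y) = ?f (h x) \<otimes>\<^bsub>G'\<^esub> ?f (h y)" if xy: "x \<in> K" "y \<in> K" for x y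
  proof -
    have "h x \<otimes>\<^bsub>G'\<^esub> h y = h (x \<otimes>\<^bsub>G\<^esub> y)" "x \<otimes>\<^bsub>G\<^esub> y \<in> K"
      using xy KG subgroup.m_closed [OF Ksub] by (simp_all add: subset_iff)
    moreover have "f (x \<otimes>\<^bsub>G\<^esub> y) = f x \<otimes>\<^bsub>G\<^esub> f y"
      using fhom xy by (simp add: hom_def)
    ultimately show ?thesis
      using fK xy by (simp only: h.hom_mult)
  qed
  moreover have "?f u \<in> carrier G'" if "u \<in> h ` K" for u
    using that fK hcl by auto
  ultimately have "?f \<in> hom (G'\<lparr>carrier := h ` K\<rparr>) G'"
    by (auto simp: hom_def simp del: comp_apply)
  then have virt: "virtual_endomorphism G' (h ` K) ?f"
    using finite_index_subgroup_image [OF G G' h Kfi] by (simp add: virtual_endomorphism_def)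
  have "?f ` (h ` K) = h ` f ` K"
    using fK(1) unfolding image_image by (intro image_cong) simp_all
  then have "?f ` (h ` K) = carrier G'"
    unfolding fonto onto .
  moreover have "N = {\<one>\<^bsub>G'\<^esub>}" if N: "N \<subseteq> h ` K" "N \<lhd> G'" "?f ` N \<subseteq> N" for N
  proof -
    have NG: "N \<subseteq> carrier G'"
      using N(1) KG hcl by blast
    have "g ` N \<lhd> G"
      by (rule iso_normal_subgroup [OF g G' G N(2)])
    moreover have "g ` N \<subseteq> K"
      using N(1) KG gh by (force simp: subset_iff)
    moreover have "f ` (g ` N) \<subseteq> g ` N"
    proof clarify
      fix u assume u: "u \<in> N"
      have "g u \<in> K"
        using u \<open>g ` N \<subseteq> K\<close> by blast
      then have "f (g u) = g (?f u)"
        using fK(2) gh by simp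
      then show "f (g u) \<in> g ` N"
        using N(3) u by blast
    qed
    ultimately have "g ` N = {\<one>\<^bsub>G\<^esub>}"
      using simple unfolding simple_virtual_endomorphism_def by blast
    moreover have "h ` g ` N = N"
    proof -
      have "(\<lambda>u. h (g u)) ` N = (\<lambda>u. u) ` N"
        using NG hg by (intro image_cong) auto
      then show ?thesis
        by (simp add: image_image)
    qed
    ultimately have "N = h ` {\<one>\<^bsub>G\<^esub>}"
      by simp
    then show ?thesis
      by simp
  qed
  ultimately show "\<exists>K f. finite_index_subgroup K (G'\<lparr>carrier := H'\<rparr>) \<and>
      simple_virtual_endomorphism G' K f \<and> recurrent_virtual_endomorphism G' K f"
    using K' virt unfolding simple_virtual_endomorphism_def recurrent_virtual_endomorphism_def
    by (intro exI [of _ "h ` K"] exI [of _ ?f]) blast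
qed

text \<open>Replaces each group by its isomorphic image in \<open>M\<close>, where
  \<open>strongly_recurrent_transfer\<close> applies, and carries the result back.\<close>

lemma strongly_recurrent_self_similar_common_completion:
  assumes M: "nilpotent_group M"
    and roots: "\<And>x y (k::nat). \<lbrakk>x \<in> carrier M; y \<in> carrier M; k \<ge> 1; x [^]\<^bsub>M\<^esub> k = y [^]\<^bsub>M\<^esub> k\<rbrakk> \<Longrightarrow> x = y"
    and G1: "fin_generated_group G1" "i \<in> mon G1 M"
      "\<And>x. x \<in> carrier M \<Longrightarrow> \<exists>k\<ge>1::nat. x [^]\<^bsub>M\<^esub> k \<in> i ` carrier G1"
    and G2: "fin_generated_group G2" "j \<in> mon G2 M"
      "\<And>x. x \<in> carrier M \<Longrightarrow> \<exists>k\<ge>1::nat. x [^]\<^bsub>M\<^esub> k \<in> j ` carrier G2"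
    and srss: "strongly_recurrent_self_similar G1"
  shows "strongly_recurrent_self_similar G2"
proof -
  interpret M: group M
    using M by (simp add: nilpotent_group_def)
  obtain n where n: "lcs M (carrier M) n = {\<one>\<^bsub>M\<^esub>}"
    using M by (auto simp: nilpotent_group_def lower_central_eq_lcs)
  obtain S1 where S1: "finite S1" "S1 \<subseteq> carrier G1" "generate G1 S1 = carrier G1" and g1: "group G1"
    using G1(1) by (auto simp: fin_generated_group_def)
  obtain S2 where S2: "finite S2" "S2 \<subseteq> carrier G2" "generate G2 S2 = carrier G2" and g2: "group G2"
    using G2(1) by (auto simp: fin_generated_group_def)
  interpret i: group_hom G1 M i
    using G1(2) g1 M.is_group by (simp add: group_hom_def group_hom_axioms_def mon_def)
  interpret j: group_hom G2 M j
    using G2(2) g2 M.is_group by (simp add: group_hom_def group_hom_axioms_def mon_def)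
  let ?A1 = "i ` carrier G1" and ?A2 = "j ` carrier G2"
  have A1: "subgroup ?A1 M" "generate M (i ` S1) = ?A1" "finite (i ` S1)"
    using i.img_is_subgroup i.generate_img [OF S1(2)] S1 by simp_all
  have A2: "subgroup ?A2 M" "generate M (j ` S2) = ?A2" "finite (j ` S2)"
    using j.img_is_subgroup j.generate_img [OF S2(2)] S2 by simp_all
  have "i \<in> iso G1 (M\<lparr>carrier := ?A1\<rparr>)" "j \<in> iso G2 (M\<lparr>carrier := ?A2\<rparr>)"
    using G1(2) G2(2) by (auto simp: iso_iff mon_def hom_def)
  then have iso: "G1 \<cong> M\<lparr>carrier := ?A1\<rparr>" "M\<lparr>carrier := ?A2\<rparr> \<cong> G2"
    by (auto intro: is_isoI group.iso_sym [OF g2])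
  have "strongly_recurrent_self_similar (M\<lparr>carrier := ?A2\<rparr>)"
  proof (rule M.strongly_recurrent_transfer [OF n _ A1 A2])
    show "strongly_recurrent_self_similar (M\<lparr>carrier := ?A1\<rparr>)"
      by (rule strongly_recurrent_self_similar_iso [OF g1 M.subgroup_imp_group [OF A1(1)] iso(1) srss])
  qed (fact roots G1(3) G2(3))+
  then show ?thesis
    by (rule strongly_recurrent_self_similar_iso [OF M.subgroup_imp_group [OF A2(1)] g2 iso(2)])
qed

theorem theoremB:
  fixes c :: nat
    and G1 :: "('a, 'b) monoid_scheme" and G2 :: "('c, 'd) monoid_scheme"
    and M1 :: "('e, 'f) monoid_scheme" and M2 :: "('g, 'h) monoid_scheme"
  assumes "c \<ge> 1"
    and "fin_generated_group G1" "torsion_free_group G1"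
      "nilpotent_group G1" "nilpotency_class G1 = c"
    and "fin_generated_group G2" "torsion_free_group G2"
      "nilpotent_group G2" "nilpotency_class G2 = c"
    and "malcev_completion G1 M1" "malcev_completion G2 M2"
    and "M1 \<cong> M2"
  shows "strongly_recurrent_self_similar G1 \<longleftrightarrow> strongly_recurrent_self_similar G2"
proof -
  have M2: "nilpotent_group M2" "group M2" and M1: "group M1"
    using assms by (auto simp: malcev_completion_def nilpotent_group_def)
  interpret M2: group M2 by (rule M2(2))
  have roots: "x = y"
    if "x \<in> carrier M2" "y \<in> carrier M2" "k \<ge> 1" "x [^]\<^bsub>M2\<^esub> k = y [^]\<^bsub>M2\<^esub> k" for x y and k :: nat
    using \<open>malcev_completion G2 M2\<close> that unfolding malcev_completion_def by (metis M2.nat_pow_closed)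
  obtain h where h: "h \<in> iso M1 M2"
    using \<open>M1 \<cong> M2\<close> by (auto simp: is_iso_def)
  obtain i where i: "i \<in> mon G1 M1"
    "\<And>x. x \<in> carrier M1 \<Longrightarrow> \<exists>k\<ge>1::nat. x [^]\<^bsub>M1\<^esub> k \<in> i ` carrier G1"
    using \<open>malcev_completion G1 M1\<close> by (auto simp: malcev_completion_def)
  obtain j where j: "j \<in> mon G2 M2"
    "\<And>x. x \<in> carrier M2 \<Longrightarrow> \<exists>k\<ge>1::nat. x [^]\<^bsub>M2\<^esub> k \<in> j ` carrier G2"
    using \<open>malcev_completion G2 M2\<close> by (auto simp: malcev_completion_def)
  interpret h: group_hom M1 M2 h
    using h M1 M2(2) iso_imp_homomorphism by (simp add: group_hom_def group_hom_axioms_def)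
  \<comment> \<open>The isomorphism of completions is absorbed into the embedding of
    \<open>G1\<close>, so that \<open>M2\<close> serves as the common completion for both
    directions.\<close>
  have hi: "h \<circ> i \<in> mon G1 M2"
    by (rule mon_compose [OF i(1)]) (use h in \<open>simp add: iso_iff_mon_epi\<close>)
  have pow: "\<exists>k\<ge>1::nat. x [^]\<^bsub>M2\<^esub> k \<in> (h \<circ> i) ` carrier G1" if x: "x \<in> carrier M2" for x
  proof -
    obtain y where y: "y \<in> carrier M1" "x = h y"
      using x h by (auto simp: iso_iff)
    obtain k where k: "k \<ge> (1::nat)" "y [^]\<^bsub>M1\<^esub> k \<in> i ` carrier G1"
      using i(2) [OF y(1)] by blast
    then have "x [^]\<^bsub>M2\<^esub> k \<in> (h \<circ> i) ` carrier G1"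
      using h.hom_nat_pow [OF y(1), of k] unfolding y(2) by force
    then show ?thesis
      using k(1) by blast
  qed
  show ?thesis
  proof
    show "strongly_recurrent_self_similar G2" if "strongly_recurrent_self_similar G1"
      by (rule strongly_recurrent_self_similar_common_completion
            [OF M2(1) _ assms(2) hi _ assms(6) j(1) _ that]) (fact roots pow j(2))+
    show "strongly_recurrent_self_similar G1" if "strongly_recurrent_self_similar G2"
      by (rule strongly_recurrent_self_similar_common_completion
            [OF M2(1) _ assms(6) j(1) _ assms(2) hi _ that]) (fact roots pow j(2))+
  qed
qed

end
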